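(* Fix an integer $k\geq 2$ and $\alpha\in\mathbb{C}$ with $\alpha\neq 0$ and $|\alpha|<2$. Let $\eta>|\alpha|-\Re\alpha+1$ and let $f\in\mathcal S_\eta(\mathbb{R})$. Then there exists a non-zero constant $C=C(k,\alpha)\in\mathbb{C}$ such that, for every function $R=R(N)>0$ satisfying $$\frac{R}{\log N}\to 0\quad\text{and}\quad \frac{(\log N)^{|\alpha|-\Re\alpha}}{R^{\eta-1}}\to 0\qquad\text{as } N\to\infty,$$ we have $$S_{\Omega,f}(k,\alpha;N)=C\cdot(\log N)^{\alpha}\cdot\left(\int_{|\lambda|\leq R}\varphi^{(\alpha)}(\lambda)\hat f(\lambda)\,\mathrm{d}\lambda+\varepsilon_N\right),$$ where $\varepsilon_N=\varepsilon_N(k,\alpha,f,R)\to 0$ as $N\to\infty$ and $$\varepsilon_N=O\!\left(\frac{\log\log N}{\log N}\right)+O\!\left(\frac{(\log N)^{|\alpha|-\Re\alpha}}{R^{\eta-1}}\right),$$ the constants implied by the $O$-notation depending on $k,\alpha,f,R$.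
   Context: An integer $n\geq1$ is $k$-free if $p^k\nmid n$ for every prime $p$. $\Omega(n)$ denotes the number of prime factors of $n$ counted with multiplicity. For a bounded $f:\mathbb{R}\to\mathbb{C}$ and $N\geq 2$ define the (finite) sum $$S_{\Omega,f}(k,\alpha;N)=\sum_{\substack{n\ k\text{-free}\\ p\mid n\Rightarrow p\leq N}} f\!\left(\frac{\log n}{\log N}\right)\frac{\alpha^{\Omega(n)}}{n},$$ the sum being over $k$-free positive integers all of whose prime factors are at most $N$. For $\eta>0$, $\mathcal S_\eta(\mathbb{R})$ is the set of functions $f:\mathbb{R}\to\mathbb{C}$ for which there is $C>0$ with $|\hat f(\lambda)|\leq C/(1+|\lambda|^\eta)$ for all $\lambda\in\mathbb{R}$, where $\hat f$ is the Fourier transform of $f$ (normalized so that $f(x)=\int_{\mathbb{R}}\hat f(\lambda)e^{i\lambda x}\,\mathrm{d}\lambda$). For $\lambda\in\mathbb{R}$, $$\varphi^{(\alpha)}(\lambda)=\exp\left\{\alpha\int_0^1\frac{e^{i\lambda v}-1}{v}\,\mathrm{d}v\right\}$$ (the characteristic function of the $\alpha$-convolution of the Dickman–de Bruijn distribution). $(\log N)^\alpha=e^{\alpha\log\log N}$. *)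

theory Defs
  imports
    "HOL-Analysis.Analysis"
    "HOL-Library.Landau_Symbols"
    "HOL-Computational_Algebra.Computational_Algebra"
begin

definition kfree :: "nat \<Rightarrow> nat \<Rightarrow> bool" where
  "kfree k n \<longleftrightarrow> n \<ge> 1 \<and> (\<forall>p. prime p \<longrightarrow> \<not> p ^ k dvd n)"

definition bigomega :: "nat \<Rightarrow> nat" where
  "bigomega n = size (prime_factorization n)"

definition kfree_smooth :: "nat \<Rightarrow> real \<Rightarrow> nat set" where
  "kfree_smooth k N = {n. kfree k n \<and> (\<forall>p. prime p \<and> p dvd n \<longrightarrow> real p \<le> N)}"

definition S_Omega :: "(real \<Rightarrow> complex) \<Rightarrow> nat \<Rightarrow> complex \<Rightarrow> real \<Rightarrow> complex" where
  "S_Omega f k \<alpha> N =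
     (\<Sum>n\<in>kfree_smooth k N. f (ln (real n) / ln N) * (\<alpha> ^ bigomega n / of_nat n))"

text \<open>The sum above ranges over a finite set, so the convention that a sum over an infinite
  set vanishes never applies.\<close>

lemma finite_kfree_smooth: "finite (kfree_smooth k N)"
proof -
  define P where "P = {p::nat. prime p \<and> real p \<le> N}"
  have "P \<subseteq> {..nat \<lfloor>N\<rfloor>}"
    unfolding P_def by (auto simp: le_nat_floor)
  then have fin: "finite P"
    using finite_subset by blast
  have "n dvd (\<Prod>p\<in>P. p ^ k)" if n: "n \<in> kfree_smooth k N" for n
  proof -
    have n0: "n \<noteq> 0" and free: "\<And>p. prime p \<Longrightarrow> \<not> p ^ k dvd n"
      and smooth: "\<And>p. prime p \<Longrightarrow> p dvd n \<Longrightarrow> real p \<le> N"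
      using n by (auto simp: kfree_smooth_def kfree_def)
    have sub: "prime_factors n \<subseteq> P"
      using smooth by (auto simp: P_def prime_factors_dvd)
    have "n = (\<Prod>p\<in>prime_factors n. p ^ multiplicity p n)"
      using n0 by (simp add: prime_factorization_nat)
    also have "\<dots> dvd (\<Prod>p\<in>prime_factors n. p ^ k)"
    proof (rule prod_dvd_prod)
      fix p assume "p \<in> prime_factors n"
      then have "prime p" by auto
      then have "multiplicity p n \<le> k"
        using free multiplicity_dvd' [of k p n] by force
      then show "p ^ multiplicity p n dvd p ^ k"
        by (rule le_imp_power_dvd)
    qed
    also have "\<dots> dvd (\<Prod>p\<in>P. p ^ k)"
      using fin sub by (rule prod_dvd_prod_subset)
    finally show ?thesis .
  qed
  then have "kfree_smooth k N \<subseteq> {d. d dvd (\<Prod>p\<in>P. p ^ k)}"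
    by blast
  moreover have "(\<Prod>p\<in>P. p ^ k) \<noteq> 0"
    using fin by (auto simp: P_def)
  ultimately show ?thesis
    using finite_subset finite_divisors_nat by blast
qed

text \<open>\<open>g\<close> is a Fourier transform of \<open>f\<close>, in the normalization that puts no constant in front of
  the inversion formula. The function \<open>f\<close> itself need not be integrable, and the inversion
  formula is required at every point; it determines \<open>g\<close> up to a null set.\<close>

definition has_fourier_transform :: "(real \<Rightarrow> complex) \<Rightarrow> (real \<Rightarrow> complex) \<Rightarrow> bool" where
  "has_fourier_transform f g \<longleftrightarrow>
     integrable lborel g \<and>
     (\<forall>x. f x = (LINT l|lborel. g l * exp (\<i> * of_real l * of_real x)))"

text \<open>For \<open>\<eta> > 1\<close> the decay condition forces a measurable \<open>g\<close> to be integrable, so the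
  integrability in \<open>has_fourier_transform\<close> is then only a measurability requirement.\<close>

definition S_class :: "real \<Rightarrow> (real \<Rightarrow> complex) set" where
  "S_class \<eta> = {f. \<exists>g. has_fourier_transform f g \<and>
     (\<exists>C>0. \<forall>l. norm (g l) \<le> C / (1 + \<bar>l\<bar> powr \<eta>))}"

text \<open>At \<open>v = 0\<close> the integrand is \<open>0\<close> because of division by zero; the point is null.\<close>

definition phi :: "complex \<Rightarrow> real \<Rightarrow> complex" where
  "phi \<alpha> l =
     exp (\<alpha> * (LINT v:{0..1}|lborel. (exp (\<i> * of_real l * of_real v) - 1) / of_real v))"

definition log_power :: "real \<Rightarrow> complex \<Rightarrow> complex" where
  "log_power N \<alpha> = exp (\<alpha> * of_real (ln (ln N)))"

end

theory Submission
  imports Defs "HOL-Probability.Probability" "HOL-Real_Asymp.Real_Asymp"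
begin

text \<open>
  By Fourier inversion and the Euler product the sum equals the integral over \<open>\<lambda>\<close> of \<open>fhat \<lambda>\<close>
  times the product of \<open>\<Sum>j<k. (\<alpha> p powr (-1 + \<i> t))^j\<close> over primes \<open>p \<le> N\<close>, with \<open>t = \<lambda> / ln N\<close>.
  Mertens' first theorem and Abel summation show that this product is
  \<open>C (ln N)^\<alpha> phi \<alpha> \<lambda> exp d\<close> with \<open>d = O((1 + \<bar>\<lambda>\<bar>) u)\<close>, \<open>u = ln (ln N) / ln N\<close>.

  For \<open>\<bar>\<lambda>\<bar> \<le> R = o(ln N)\<close> the error \<open>d\<close> need not be bounded, but \<open>exp \<bar>d\<bar>\<close> is at most any fixed
  positive power of \<open>ln N\<close>. As \<open>fhat \<lambda> * phi \<alpha> \<lambda>\<close> decays like \<open>\<bar>\<lambda>\<bar>\<close> to the power \<open>- Re \<alpha> - \<eta>\<close>, where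
  \<open>Re \<alpha> + \<eta> - 1 > \<bar>\<alpha>\<bar>\<close>, bounding \<open>\<bar>exp d - 1\<bar>\<close> by \<open>\<bar>d\<bar> powr \<theta> * exp \<bar>d\<bar>\<close> with
  \<open>\<theta> = Re \<alpha> + \<eta> - 1 - \<bar>\<alpha>\<bar> / 2\<close> leaves a convergent integral and an error below
  \<open>(ln N) powr (\<bar>\<alpha>\<bar> - Re \<alpha> + 1 - \<eta>)\<close>, which is dominated by the second error term because
  \<open>R \<le> ln N\<close>. The range \<open>\<bar>\<lambda>\<bar> > R\<close> is estimated trivially by \<open>(ln N) powr \<bar>\<alpha>\<bar>\<close>.
  Levy's uniqueness theorem shows that the given \<open>fhat\<close> is the one that decays.
\<close>

section \<open>Mertens' first theorem\<close>

text \<open>One step of Legendre's formula: the multiples of \<open>p\<close> up to \<open>n\<close>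
  give one factor \<open>p\<close> each, and dividing these out leaves
  \<open>fact (n div p)\<close>. In the induction both sides change only when \<open>p\<close>
  divides \<open>Suc n\<close>.\<close>

lemma multiplicity_fact_div:
  assumes "prime (p::nat)"
  shows "multiplicity p (fact n :: nat) = n div p + multiplicity p (fact (n div p) :: nat)"
proof (induction n)
  case (Suc n)
  have p: "prime_elem p" "p > 1" using assms prime_gt_1_nat by auto
  have L: "multiplicity p (fact (Suc n) :: nat) = multiplicity p (Suc n) + multiplicity p (fact n :: nat)"
    using p by (simp only: fact_Suc of_nat_id) (subst prime_elem_multiplicity_mult_distrib, auto)
  show ?case
  proof (cases "p dvd Suc n")
    case True
    then obtain q where q: "Suc n = p * q" by auto
    then obtain r where r: "q = Suc r" by (cases q) auto
    have d1: "Suc n div p = Suc r" using q r p by simp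
    have d2: "n div p = r"
    proof -
      have "Suc n = Suc ((p - 1) + r * p)" using q r p by (simp add: algebra_simps)
      then have "n = (p - 1) + r * p" by simp
      then have "n div p = (p - 1) div p + r" using p by (metis add.commute div_mult_self1 not_one_less_zero)
      then show ?thesis using p by simp
    qed
    have "multiplicity p (Suc n) = Suc (multiplicity p (Suc r))"
      unfolding q r using p by (subst multiplicity_times_same) auto
    moreover have "multiplicity p (fact (Suc r) :: nat) = multiplicity p (Suc r) + multiplicity p (fact r :: nat)"
      using p by (simp only: fact_Suc of_nat_id) (subst prime_elem_multiplicity_mult_distrib, auto)
    ultimately show ?thesis using L Suc d1 d2 by simp
  next
    case False
    then have "Suc n div p = n div p" using div_Suc by (metis mod_0_imp_dvd mod_Suc)
    moreover have "multiplicity p (Suc n) = 0" using False by (rule not_dvd_imp_multiplicity_0)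
    ultimately show ?thesis using L Suc by simp
  qed
qed auto

text \<open>The geometric series n/p + n/p^2 + ... = n/(p - 1), obtained by iterating Legendre's
  step and cleared of its denominator so as to stay in the naturals.\<close>

lemma multiplicity_fact_le:
  assumes "prime (p::nat)"
  shows "multiplicity p (fact n :: nat) * (p - 1) \<le> n"
proof (induction n rule: less_induct)
  case (less n)
  have p: "p > 1" using assms prime_gt_1_nat by auto
  show ?case
  proof (cases "n = 0")
    case False
    then have "n div p < n" using p by simp
    from less[OF this] have "multiplicity p (fact n :: nat) * (p - 1) \<le> (n div p) * (p - 1) + n div p"
      by (subst multiplicity_fact_div[OF assms]) (simp add: distrib_right)
    also have "\<dots> = (n div p) * p" using p by (cases p) auto
    also have "\<dots> \<le> n" by simp
    finally show ?thesis .
  qed auto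
qed

abbreviation primes_upto :: "nat \<Rightarrow> nat set" where
  "primes_upto n \<equiv> {p. prime p \<and> p \<le> n}"

lemma finite_primes_upto: "finite (primes_upto n)"
  by (rule finite_subset[of _ "{..n}"]) auto

text \<open>Links the factorial, whose size is known, to the primes up to \<open>n\<close>;
  comparing the two expressions yields Mertens' first theorem.\<close>

lemma ln_fact_eq:
  "ln (fact n :: real) = (\<Sum>p\<in>primes_upto n. real (multiplicity p (fact n :: nat)) * ln (real p))"
proof -
  have sub: "prime_factors (fact n :: nat) \<subseteq> primes_upto n"
    using prime_dvd_fact_iff by (auto simp: prime_factors_dvd)
  have "(fact n :: nat) = (\<Prod>p\<in>prime_factors (fact n). p ^ multiplicity p (fact n :: nat))"
    by (rule prime_factorization_nat) simp
  also have "\<dots> = (\<Prod>p\<in>primes_upto n. p ^ multiplicity p (fact n :: nat))"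
    by (rule prod.mono_neutral_left[OF finite_primes_upto sub]) (auto simp: prime_factors_multiplicity)
  finally have "real (fact n) = (\<Prod>p\<in>primes_upto n. real p ^ multiplicity p (fact n :: nat))"
    by (metis (no_types, lifting) of_nat_power of_nat_prod prod.cong)
  then have "ln (fact n :: real) = ln (\<Prod>p\<in>primes_upto n. real p ^ multiplicity p (fact n :: nat))"
    by (simp add: of_nat_fact)
  also have "\<dots> = (\<Sum>p\<in>primes_upto n. ln (real p ^ multiplicity p (fact n :: nat)))"
    by (rule ln_prod[OF finite_primes_upto]) (auto simp: prime_gt_0_nat)
  also have "\<dots> = (\<Sum>p\<in>primes_upto n. real (multiplicity p (fact n :: nat)) * ln (real p))"
    by (intro sum.cong refl ln_realpow)
  finally show ?thesis .
qed

lemma ln_fact_le: "ln (fact n :: real) \<le> n * ln n"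
proof (cases "n = 0")
  case False
  have "(fact n :: real) \<le> real n ^ n"
    using fact_le_power[of n, where 'a = real] by simp
  then have "ln (fact n :: real) \<le> ln (real n ^ n)" by (intro ln_mono) auto
  then show ?thesis using False by (simp add: ln_realpow)
qed auto

text \<open>Together with \<open>ln_fact_le\<close> a weak form of Stirling's formula with error
  O(n). The induction step reduces to \<open>n * (ln (n + 1) - ln n) \<le> 1\<close>.\<close>

lemma ln_fact_ge: "real n * ln n - n \<le> ln (fact n :: real)"
proof (induction n)
  case (Suc n)
  show ?case
  proof (cases "n = 0")
    case False
    have "ln (1 + 1 / real n) \<le> 1 / real n" by (rule ln_add_one_self_le_self) auto
    moreover have "1 + 1 / real n = real (Suc n) / n" using False by (simp add: field_simps)
    ultimately have "ln (real (Suc n)) - ln n \<le> 1 / n" using False by (simp add: ln_div)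
    then have "n * (ln (real (Suc n)) - ln n) \<le> 1" using False by (simp add: field_simps)
    moreover have "ln (fact (Suc n) :: real) = ln (real (Suc n)) + ln (fact n :: real)"
      by (simp only: fact_Suc) (subst ln_mult, auto)
    ultimately show ?thesis using Suc by (simp add: algebra_simps)
  qed auto
qed auto

section \<open>Chebyshev's function and its linear bound\<close>

definition theta :: "nat \<Rightarrow> real" where "theta n = (\<Sum>p\<in>primes_upto n. ln (real p))"

text \<open>Every prime in \<open>(n, 2n]\<close> divides the central binomial coefficient.\<close>

lemma theta_double: "theta (2 * n) \<le> theta n + n * ln 4"
proof -
  define Q where "Q = {p::nat. prime p \<and> n < p \<and> p \<le> 2 * n}"
  have finQ: "finite Q" unfolding Q_def by (rule finite_subset[of _ "{..2*n}"]) auto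
  have un: "primes_upto (2 * n) = primes_upto n \<union> Q" "primes_upto n \<inter> Q = {}"
    by (auto simp: Q_def)
  have dv: "p dvd (2 * n) choose n" if "p \<in> Q" for p
  proof -
    have p: "prime p" "n < p" "p \<le> 2 * n" using that by (auto simp: Q_def)
    have "fact n * fact (2 * n - n) * ((2 * n) choose n) = (fact (2 * n) :: nat)"
      by (rule binomial_fact_lemma) simp
    moreover have "p dvd fact (2 * n)" using p prime_dvd_fact_iff by blast
    moreover have "\<not> p dvd fact n" using p prime_dvd_fact_iff[of p n] by auto
    moreover have "2 * n - n = n" by simp
    ultimately show ?thesis using p(1) by (metis prime_dvd_mult_iff)
  qed
  \<comment> \<open>Divisibility passes from single primes to their product because distinct primes
    are coprime.\<close>
  have "\<Prod>F dvd (2 * n) choose n" if "finite F" "F \<subseteq> Q" for F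
    using that
  proof (induction F rule: finite_induct)
    case (insert x F)
    have "coprime x (\<Prod>F)"
      using insert by (intro prod_coprime_right primes_coprime) (auto simp: Q_def)
    then show ?case using insert dv by (auto intro!: divides_mult)
  qed auto
  from this[OF finQ order_refl] have "\<Prod>Q dvd (2 * n) choose n" .
  then have "\<Prod>Q \<le> (2 * n) choose n" by (intro dvd_imp_le) auto
  also have "\<dots> \<le> 2 ^ (2 * n)" by (rule binomial_le_pow2)
  finally have "real (\<Prod>Q) \<le> real (2 ^ (2 * n))" using of_nat_le_iff by blast
  then have "(\<Prod>p\<in>Q. real p) \<le> 4 ^ n" by (simp add: power_mult)
  then have "ln (\<Prod>p\<in>Q. real p) \<le> ln (4 ^ n)"
    by (intro ln_mono) (auto intro!: prod_pos simp: Q_def prime_gt_0_nat)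
  moreover have "ln (\<Prod>p\<in>Q. real p) = (\<Sum>p\<in>Q. ln (real p))"
    by (rule ln_prod[OF finQ]) (auto simp: Q_def prime_gt_0_nat)
  moreover have "theta (2 * n) = theta n + (\<Sum>p\<in>Q. ln (real p))"
    unfolding theta_def un(1) by (rule sum.union_disjoint[OF finite_primes_upto finQ un(2)])
  ultimately show ?thesis by (simp add: ln_realpow)
qed

lemma theta_mono: "m \<le> n \<Longrightarrow> theta m \<le> theta n"
  unfolding theta_def
  by (rule sum_mono2[OF finite_primes_upto]) (auto simp: prime_gt_0_nat Suc_leI)

lemma theta_le: "theta n \<le> 2 * ln 4 * n"
proof (induction n rule: less_induct)
  case (less n)
  show ?case
  proof (cases "n \<le> 1")
    case True
    have "p \<notin> primes_upto n" for p using True prime_gt_1_nat[of p] by auto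
    then have "primes_upto n = {}" by blast
    then show ?thesis unfolding theta_def by (simp only: sum.empty) simp
  next
    case False
    \<comment> \<open>Rounding up keeps \<open>n \<le> 2 * m\<close> for odd \<open>n\<close>. The
      induction needs \<open>m * 2 * ln 4 + m * ln 4\<close> to stay below
      \<open>2 * n * ln 4\<close>, that is, \<open>3 * m \<le> 2 * n\<close>, which holds from
      \<open>n = 2\<close> on.\<close>
    define m where "m = (n + 1) div 2"
    have m: "m < n" "n \<le> 2 * m" "3 * m \<le> 2 * n" using False unfolding m_def by linarith+
    have "theta n \<le> theta m + m * ln 4" using theta_mono[OF m(2)] theta_double[of m] by simp
    also have "\<dots> \<le> (3 * real m) * ln 4" using less[OF m(1)] by (simp add: algebra_simps)
    also have "\<dots> \<le> (2 * real n) * ln 4" using m(3) by (intro mult_right_mono) auto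
    finally show ?thesis by (simp add: mult_ac)
  qed
qed

text \<open>Since \<open>ln p \<le> 2 * sqrt p\<close>, a convergent series of exponent -3/2
  dominates. The bound serves twice: for the higher prime powers in \<open>fact n\<close>, and for
  the dependence on \<open>t\<close> of the second-order part of the Euler factors.\<close>

lemma sum_primes_ln_over_square:
  obtains c where "\<And>n. (\<Sum>p\<in>primes_upto n. ln p / p^2) \<le> c"
proof -
  define s where "s = (\<lambda>n::nat. 2 * real n powr (-3/2))"
  have sm: "summable s" unfolding s_def by (intro summable_mult) (simp add: summable_real_powr_iff)
  have bd: "ln p / p^2 \<le> s p" if "p \<ge> 2" for p :: nat
  proof -
    have "ln (sqrt p) \<le> sqrt p - 1" by (rule ln_le_minus_one) (use that in auto)
    then have l: "ln p \<le> 2 * sqrt p" using that by (simp add: ln_sqrt)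
    then have "ln p / p^2 \<le> 2 * sqrt p / p^2" by (intro divide_right_mono) auto
    also have "\<dots> = s p"
    proof -
      have "real p powr (-3/2) = p powr (1/2) * p powr (-2)" by (simp flip: powr_add)
      also have "\<dots> = sqrt p / (real p)^2" using that by (simp add: powr_half_sqrt powr_minus powr_realpow divide_simps)
      finally show ?thesis unfolding s_def by simp
    qed
    finally show ?thesis by simp
  qed
  define c where "c = suminf s"
  have c: "(\<Sum>p\<in>primes_upto n. ln p / p^2) \<le> c" for n
  proof -
    have "(\<Sum>p\<in>primes_upto n. ln p / p^2) \<le> (\<Sum>p\<in>primes_upto n. s p)"
      by (intro sum_mono bd) (auto simp: prime_ge_2_nat)
    also have "\<dots> \<le> c" unfolding c_def
      by (intro sum_le_suminf sm finite_primes_upto) (auto simp: s_def)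
    finally show ?thesis .
  qed
  then show ?thesis using that by blast
qed

text \<open>The prime sum is carried by a weight on all integers, so that Abel summation can run
  over consecutive integers.\<close>

definition mertens_weight :: "nat \<Rightarrow> real" where
  "mertens_weight n = (if prime n then ln n / n else 0)"

lemma sum_mertens_weight: "(\<Sum>m=1..n. mertens_weight m) = (\<Sum>p\<in>primes_upto n. ln p / p)"
  unfolding mertens_weight_def
  by (subst sum.inter_filter[symmetric]) (auto intro!: sum.cong simp: prime_gt_0_nat Suc_leI)

text \<open>The multiplicity of \<open>p\<close> in \<open>fact n\<close> is \<open>n / p\<close> up
  to errors that sum to O(n) after weighting by \<open>ln p\<close>: Chebyshev's bound controls the
  rounding in \<open>n div p\<close>, the convergence of the sum of \<open>ln p / p^2\<close>
  controls the higher powers. Stirling's formula divided by \<open>n\<close> then gives the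
  claim.\<close>

lemma mertens_first:
  obtains c where "c > 0" "\<And>n. n \<ge> 1 \<Longrightarrow> \<bar>(\<Sum>m=1..n. mertens_weight m) - ln n\<bar> \<le> c"
proof -
  obtain c where c: "\<And>n. (\<Sum>p\<in>primes_upto n. ln p / p^2) \<le> c"
    using sum_primes_ln_over_square by blast
  \<comment> \<open>The factor 2 pays for \<open>p - 1 \<ge> p / 2\<close>.\<close>
  define c0 where "c0 = 2 * c"
  have c0: "(\<Sum>p\<in>primes_upto n. ln p / (p * (p - 1))) \<le> c0" for n
  proof -
    have "(\<Sum>p\<in>primes_upto n. ln p / (p * (p - 1))) \<le> (\<Sum>p\<in>primes_upto n. 2 * (ln p / p^2))"
    proof (rule sum_mono)
      fix p assume "p \<in> primes_upto n"
      then have p: "p \<ge> 2" using prime_ge_2_nat by force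
      then have "ln p / (p * (p - 1)) \<le> ln p / (p * (p / 2))"
        by (intro divide_left_mono) (auto simp: field_simps of_nat_diff)
      also have "\<dots> = 2 * (ln p / p^2)" by (simp add: power2_eq_square)
      finally show "ln p / (p * (p - 1)) \<le> 2 * (ln p / p^2)" .
    qed
    also have "\<dots> \<le> c0" unfolding c0_def sum_distrib_left[symmetric] using c[of n] by simp
    finally show ?thesis .
  qed
  have c0p: "c0 \<ge> 0" using c0[of 0] by simp
  have main: "\<bar>(\<Sum>m=1..n. mertens_weight m) - ln n\<bar> \<le> 2 * ln 4 + 1 + c0" if n: "n \<ge> 1" for n
  proof -
    define A where "A = (\<Sum>p\<in>primes_upto n. ln p / p)"
    \<comment> \<open>Upper bound for \<open>A\<close>: discarding the higher powers and rounding
      down lose at most \<open>ln p\<close> for each prime, in total \<open>theta n\<close>.\<close>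
    have "n * A - theta n = (\<Sum>p\<in>primes_upto n. (n / p - 1) * ln p)"
      unfolding A_def theta_def by (simp add: sum_distrib_left sum_subtractf algebra_simps)
    also have "\<dots> \<le> ln (fact n :: real)" unfolding ln_fact_eq
    proof (intro sum_mono mult_right_mono)
      fix p assume "p \<in> primes_upto n"
      then have p: "prime p" by auto
      have "n / p - 1 \<le> real (n div p)"
        using floor_divide_of_nat_eq[of n p, where 'a = real] by linarith
      also have "\<dots> \<le> multiplicity p (fact n :: nat)" using multiplicity_fact_div[OF p, of n] by simp
      finally show "n / p - 1 \<le> multiplicity p (fact n :: nat)" .
      show "ln p \<ge> 0" using prime_ge_1_nat[OF p] by simp
    qed
    also have "\<dots> \<le> n * ln n" by (rule ln_fact_le)
    finally have "n * A \<le> n * (ln n + 2 * ln 4)" using theta_le[of n] by (simp add: algebra_simps)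
    then have up: "A \<le> ln n + 2 * ln 4" using n by simp
    \<comment> \<open>Lower bound for \<open>A\<close>: 1/(p - 1) = 1/p + 1/(p (p - 1)), and the
      second part contributes at most \<open>c0\<close>.\<close>
    have "ln (fact n :: real) \<le> (\<Sum>p\<in>primes_upto n. n / (p - 1) * ln p)" unfolding ln_fact_eq
    proof (intro sum_mono mult_right_mono)
      fix p assume "p \<in> primes_upto n"
      then have p: "prime p" by auto
      have "real (multiplicity p (fact n :: nat) * (p - 1)) \<le> n"
        using multiplicity_fact_le[OF p, of n] of_nat_le_iff by blast
      then show "multiplicity p (fact n :: nat) \<le> n / (p - 1)"
        using prime_ge_2_nat[OF p] by (simp add: field_simps of_nat_diff)
      show "ln p \<ge> 0" using prime_ge_1_nat[OF p] by simp
    qed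
    also have "\<dots> = (\<Sum>p\<in>primes_upto n. n * (ln p / p) + n * (ln p / (p * (p - 1))))"
    proof (intro sum.cong refl)
      fix p assume "p \<in> primes_upto n"
      then have p: "real p \<ge> 2" using prime_ge_2_nat by force
      show "n / (p - 1) * ln p = n * (ln p / p) + n * (ln p / (p * (p - 1)))"
        using p by (simp add: field_simps)
    qed
    also have "\<dots> = n * A + n * (\<Sum>p\<in>primes_upto n. ln p / (p * (p - 1)))"
      unfolding A_def by (simp add: sum.distrib sum_distrib_left)
    also have "\<dots> \<le> n * A + n * c0" using c0[of n] by (intro add_left_mono mult_left_mono) auto
    finally have "n * (ln n - 1) \<le> n * (A + c0)" using ln_fact_ge[of n] by (simp add: algebra_simps)
    then have lo: "ln n - 1 \<le> A + c0" using n by simp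
    have "(ln 4 :: real) \<ge> 0" by simp
    then show ?thesis unfolding sum_mertens_weight A_def[symmetric] using up lo c0p by linarith
  qed
  show ?thesis
  proof (rule that[of "2 * ln 4 + 1 + c0"])
    have "(ln 4 :: real) \<ge> 0" by simp
    then show "2 * ln 4 + 1 + c0 > 0" using c0p by linarith
  qed (rule main)
qed

section \<open>Abel summation against a logarithmically distributed weight\<close>

lemma norm_diff_le_vector_derivative:
  fixes f :: "real \<Rightarrow> 'a::real_normed_vector"
  assumes "a \<le> b" and d: "\<And>x. a \<le> x \<Longrightarrow> x \<le> b \<Longrightarrow> (f has_vector_derivative f' x) (at x)"
    and B: "\<And>x. a \<le> x \<Longrightarrow> x \<le> b \<Longrightarrow> norm (f' x) \<le> B"
  shows "norm (f b - f a) \<le> B * (b - a)"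
proof -
  have "norm (f b - f a) \<le> B * norm (b - a)"
  proof (rule differentiable_bound[of "{a..b}" f "\<lambda>x h. h *\<^sub>R f' x"])
    fix x assume x: "x \<in> {a..b}"
    then show "(f has_derivative (\<lambda>h. h *\<^sub>R f' x)) (at x within {a..b})"
      using d[of x] by (auto simp: has_vector_derivative_def intro: has_derivative_at_withinI)
    show "onorm (\<lambda>h. h *\<^sub>R f' x) \<le> B"
      using B[of x] x by (intro onorm_le) (auto simp: mult.commute[of B] intro: mult_left_mono)
  qed (use assms in auto)
  then show ?thesis using assms by simp
qed

text \<open>On average \<open>a\<close> has density 1/x, so the sum is compared with the integral of
  \<open>H x / x\<close>, whose primitive is \<open>\<Phi>\<close>. \<open>V n\<close> bounds the
  oscillation of \<open>H\<close> on [n, n + 1]; it is paid \<open>c\<close> times in the summation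
  by parts and once more in the comparison with the integral.\<close>

lemma abel_summation_log_weights:
  fixes a :: "nat \<Rightarrow> real" and H \<Phi> :: "real \<Rightarrow> complex" and V :: "nat \<Rightarrow> real"
  assumes c: "\<And>n. n \<ge> 1 \<Longrightarrow> \<bar>(\<Sum>m=1..n. a m) - ln n\<bar> \<le> c"
    and M: "M \<ge> 1" "M \<le> N"
    and d: "\<And>x. x \<ge> real M \<Longrightarrow> (\<Phi> has_vector_derivative H x / of_real x) (at x)"
    and V: "\<And>n x. n \<ge> M \<Longrightarrow> real n \<le> x \<Longrightarrow> x \<le> real (Suc n) \<Longrightarrow> norm (H (real (Suc n)) - H x) \<le> V n"
  shows "norm ((\<Sum>n=Suc M..N. of_real (a n) * H (real n)) - (\<Phi> N - \<Phi> M))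
    \<le> c * (norm (H N) + norm (H M)) + (c + 1) * (\<Sum>n=M..<N. V n)"
proof -
  define \<tau> where "\<tau> = (\<lambda>n. (\<Sum>m=1..n. a m) - ln (real n))"
  define \<Delta> where "\<Delta> = (\<lambda>n. H (real (Suc n)) * of_real (ln (Suc n) - ln n) - (\<Phi> (Suc n) - \<Phi> n))"
  \<comment> \<open>Each \<open>a (Suc n)\<close> is the increment of \<open>\<tau>\<close> plus
    that of \<open>ln\<close>. The first part is summed by parts, the second is compared with the
    increment of \<open>\<Phi>\<close>, leaving \<open>\<Delta>\<close>.\<close>
  have id: "(\<Sum>n=Suc M..N. of_real (a n) * H (real n)) - (\<Phi> N - \<Phi> M)
      = of_real (\<tau> N) * H N - of_real (\<tau> M) * H M - (\<Sum>n=M..<N. of_real (\<tau> n) * (H (real (Suc n)) - H n))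
        + (\<Sum>n=M..<N. \<Delta> n)"
    using M(2)
  proof (induction N rule: dec_induct)
    case (step n)
    have "a (Suc n) = \<tau> (Suc n) - \<tau> n + (ln (Suc n) - ln n)" by (simp add: \<tau>_def)
    then have e: "(of_real (a (Suc n)) :: complex) = of_real (\<tau> (Suc n)) - of_real (\<tau> n) + of_real (ln (Suc n) - ln n)"
      by (metis of_real_add of_real_diff)
    have A: "(\<Sum>m=Suc M..Suc n. of_real (a m) * H (real m)) = (\<Sum>m=Suc M..n. of_real (a m) * H (real m)) + of_real (a (Suc n)) * H (real (Suc n))"
      using step by simp
    have B: "(\<Sum>m=M..<Suc n. g m) = (\<Sum>m=M..<n. g m) + g n" for g :: "nat \<Rightarrow> complex"
      using step by simp
    have D: "\<Delta> n = H (real (Suc n)) * of_real (ln (Suc n) - ln n) - (\<Phi> (Suc n) - \<Phi> n)"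
      by (simp add: \<Delta>_def)
    show ?case unfolding A B e D using step.IH by algebra
  qed simp
  have \<tau>: "\<bar>\<tau> n\<bar> \<le> c" if "n \<ge> M" for n using c[of n] M that by (simp add: \<tau>_def)
  have \<Delta>: "norm (\<Delta> n) \<le> V n" if n: "n \<ge> M" for n
  proof -
    \<comment> \<open>The increment of \<open>D\<close> over [n, n + 1] is
      \<open>\<Delta> n\<close>, and its derivative is \<open>(H (n + 1) - H x) / x\<close>, bounded
      by the oscillation of \<open>H\<close>.\<close>
    define D where "D = (\<lambda>x. H (real (Suc n)) * of_real (ln x) - \<Phi> x)"
    have "norm (D (real (Suc n)) - D n) \<le> V n * (real (Suc n) - n)"
    proof (rule norm_diff_le_vector_derivative)
      fix x assume x: "real n \<le> x" "x \<le> real (Suc n)"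
      have xp: "x \<ge> 1" using x n M by linarith
      have l: "((\<lambda>x. complex_of_real (ln x)) has_vector_derivative of_real (1 / x)) (at x)"
        using xp by (intro has_vector_derivative_of_real)
           (auto simp flip: has_real_derivative_iff_has_vector_derivative intro!: derivative_eq_intros)
      show "(D has_vector_derivative (H (real (Suc n)) * of_real (1 / x) - H x / of_real x)) (at x)"
        unfolding D_def
        by (intro has_vector_derivative_diff has_vector_derivative_mult_right l d) (use x n in linarith)
      have "norm (H (real (Suc n)) * of_real (1 / x) - H x / of_real x) = norm (H (real (Suc n)) - H x) / x"
        using xp by (simp add: norm_divide flip: diff_divide_distrib)
      also have "\<dots> \<le> norm (H (real (Suc n)) - H x) / 1" using xp by (intro divide_left_mono) auto
      also have "\<dots> \<le> V n" using V[OF n x] by simp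
      finally show "norm (H (real (Suc n)) * of_real (1 / x) - H x / of_real x) \<le> V n" .
    qed simp
    also have "D (real (Suc n)) - D n = \<Delta> n" by (simp add: D_def \<Delta>_def algebra_simps)
    finally show ?thesis by simp
  qed
  have c0: "c \<ge> 0" using \<tau>[of M] by simp
  have s1: "norm (\<Sum>n=M..<N. of_real (\<tau> n) * (H (real (Suc n)) - H n)) \<le> (\<Sum>n=M..<N. c * V n)"
  proof (rule sum_norm_le)
    fix n assume n: "n \<in> {M..<N}"
    have "norm (H (real (Suc n)) - H n) \<le> V n" using V[of n "real n"] n by simp
    then show "norm (of_real (\<tau> n) * (H (real (Suc n)) - H n)) \<le> c * V n"
      unfolding norm_mult norm_of_real using \<tau>[of n] n c0 by (intro mult_mono) auto
  qed
  have s2: "norm (\<Sum>n=M..<N. \<Delta> n) \<le> (\<Sum>n=M..<N. V n)"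
    by (rule sum_norm_le) (use \<Delta> in auto)
  have s3: "norm (of_real (\<tau> N) * H N) \<le> c * norm (H N)" "norm (of_real (\<tau> M) * H M) \<le> c * norm (H M)"
    unfolding norm_mult norm_of_real using \<tau>[of N] \<tau>[of M] M by (auto intro: mult_right_mono)
  show ?thesis unfolding id using s1 s2 s3
    by (simp only: sum_distrib_left[symmetric] distrib_left distrib_right mult_1_left)
       (smt (verit) norm_triangle_ineq norm_triangle_ineq4)
qed

section \<open>Growth of phi\<close>

text \<open>The exponent of \<open>phi\<close> without the factor \<open>\<alpha>\<close>; in terms
  of the entire exponential integral it is -Ein(-i l).\<close>

definition expint_ratio :: "real \<Rightarrow> complex" where
  "expint_ratio l = (LINT v:{0..1}|lborel. (exp (\<i> * of_real l * of_real v) - 1) / of_real v)"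

lemma norm_exp_ii_minus_one_le: "norm (exp (\<i> * of_real y) - 1) \<le> \<bar>y\<bar>"
proof -
  have "norm (exp (\<i> * of_real (max 0 y)) - exp (\<i> * of_real (min 0 y))) \<le> 1 * (max 0 y - min 0 y)"
    by (rule norm_diff_le_vector_derivative[where f' = "\<lambda>x. \<i> * exp (\<i> * of_real x)"])
       (auto intro!: derivative_eq_intros simp: norm_mult has_vector_derivative_real_field)
  then show ?thesis by (auto simp: max_def min_def norm_minus_commute split: if_splits)
qed

text \<open>The singularity at \<open>v = 0\<close> is removable. Filling in the limit
  \<open>\<i> * l\<close> makes the integrand continuous, which prepares differentiation under the
  integral sign.\<close>

lemma expint_ratio_eq_integral:
  shows "expint_ratio l = integral {0..1} (\<lambda>v. if v = 0 then \<i> * of_real l else (exp (\<i> * of_real l * of_real v) - 1) / of_real v)"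
  (is "_ = integral _ ?g0")
  and "(\<lambda>v. if v = 0 then \<i> * of_real l else (exp (\<i> * of_real l * of_real v) - 1) / complex_of_real v) integrable_on {0..1}"
proof -
  have cont: "continuous_on {0..1} (?g0)"
  proof (rule continuous_on_eq_continuous_within[THEN iffD2], rule ballI)
    fix v :: real assume v: "v \<in> {0..1}"
    have "isCont (?g0) v"
    proof (cases "v = 0")
      case False
      have "isCont (\<lambda>v. (exp (\<i> * of_real l * of_real v) - 1) / complex_of_real v) v"
        using False by (intro continuous_intros) auto
      moreover have "eventually (\<lambda>w. ?g0 w = (exp (\<i> * of_real l * of_real w) - 1) / complex_of_real w) (nhds v)"
        using False by (intro eventually_mono[OF t1_space_nhds[of v 0]]) auto
      ultimately show ?thesis by (subst isCont_cong)
    next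
      case True
      have of0: "filterlim complex_of_real (at 0) (at 0)"
        by (rule filterlim_atI) (auto intro!: tendsto_eq_intros simp: eventually_at_filter)
      have "((\<lambda>w. exp (\<i> * of_real l * w)) has_field_derivative \<i> * of_real l) (at 0)"
        by (auto intro!: derivative_eq_intros)
      then have "((\<lambda>w. (exp (\<i> * of_real l * of_real w) - 1) / complex_of_real w) \<longlongrightarrow> \<i> * of_real l) (at (0::real))"
        using filterlim_compose[OF _ of0] by (auto simp: has_field_derivative_iff)
      then have "(?g0 \<longlongrightarrow> \<i> * of_real l) (at (0::real))"
        by (rule Lim_transform_eventually) (auto simp: eventually_at_filter)
      then show ?thesis unfolding True isCont_def by simp
    qed
    then show "continuous (at v within {0..1}) (?g0)" by (rule continuous_at_imp_continuous_at_within)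
  qed
  then show "?g0 integrable_on {0..1}" by (rule integrable_continuous_interval)
  have "set_integrable lborel {0..1} (?g0)"
    unfolding set_integrable_def by (rule borel_integrable_compact[OF _ cont]) simp
  then have "(LINT v:{0..1}|lborel. ?g0 v) = integral {0..1} (?g0)"
    by (rule set_borel_integral_eq_integral)
  moreover have "(LINT v:{0..1}|lborel. ?g0 v) = expint_ratio l"
    unfolding expint_ratio_def set_lebesgue_integral_def
  proof (rule integral_cong_AE)
    show "AE v in lborel. indicator {0..1} v *\<^sub>R ?g0 v =
        indicator {0..1} v *\<^sub>R ((exp (\<i> * of_real l * of_real v) - 1) / complex_of_real v)"
      using AE_lborel_singleton[of 0] by eventually_elim simp
  qed measurable
  ultimately show "expint_ratio l = integral {0..1} (?g0)" by simp
qed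

text \<open>The derivative of \<open>expint_ratio\<close>, continued by its limit at 0.\<close>

definition expint_kernel :: "real \<Rightarrow> complex" where
  "expint_kernel y = (if y = 0 then \<i> else (exp (\<i> * of_real y) - 1) / of_real y)"

lemma norm_expint_kernel_le: "norm (expint_kernel y) \<le> 1"
  using norm_exp_ii_minus_one_le[of y] by (auto simp: expint_kernel_def norm_divide divide_simps)

text \<open>Differentiating under the integral in \<open>l\<close> cancels the denominator
  \<open>v\<close> and leaves the integral of i exp(i y v) over [0, 1]. The value filled in at
  \<open>v = 0\<close> has the matching derivative \<open>\<i>\<close>.\<close>

lemma expint_ratio_deriv: "(expint_ratio has_vector_derivative expint_kernel y) (at y)"
proof -
  let ?g = "\<lambda>l v. if v = 0 then \<i> * of_real l else (exp (\<i> * of_real l * of_real v) - 1) / complex_of_real v"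
  have "((\<lambda>l. integral (cbox 0 1) (?g l)) has_vector_derivative integral (cbox 0 1) (\<lambda>v. \<i> * exp (\<i> * of_real y * of_real v))) (at y within UNIV)"
  proof (rule leibniz_rule_vector_derivative[where fx = "\<lambda>l v. \<i> * exp (\<i> * of_real l * of_real v)"])
    fix l v :: real
    show "((\<lambda>l. ?g l v) has_vector_derivative \<i> * exp (\<i> * of_real l * of_real v)) (at l within UNIV)"
      by (rule has_vector_derivative_real_field) (cases "v = 0"; auto intro!: derivative_eq_intros)
    show "?g l integrable_on cbox 0 1" using expint_ratio_eq_integral(2)[of l] by simp
  qed (auto intro!: continuous_intros simp: case_prod_beta')
  moreover have "(\<lambda>l. integral (cbox 0 1) (?g l)) = expint_ratio"
    by (auto simp: expint_ratio_eq_integral(1))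
  moreover have "integral (cbox 0 1) (\<lambda>v. \<i> * exp (\<i> * of_real y * of_real v)) = expint_kernel y"
  proof (cases "y = 0")
    case False
    have "((\<lambda>v. \<i> * exp (\<i> * of_real y * of_real v)) has_integral
       (exp (\<i> * of_real y * of_real 1) / of_real y - exp (\<i> * of_real y * of_real 0) / of_real y)) {0..1}"
      by (rule fundamental_theorem_of_calculus, simp, rule has_vector_derivative_at_within, rule has_vector_derivative_real_field)
         (use False in \<open>auto intro!: derivative_eq_intros\<close>)
    from integral_unique[OF this] show ?thesis
      unfolding cbox_interval using False by (simp only:) (simp add: expint_kernel_def diff_divide_distrib)
  qed (simp add: expint_kernel_def)
  ultimately show ?thesis by simp
qed

lemma norm_expint_ratio_diff_le: "norm (expint_ratio x - expint_ratio y) \<le> \<bar>x - y\<bar>"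
proof -
  have *: "norm (expint_ratio b - expint_ratio a) \<le> b - a" if "a \<le> b" for a b
    using norm_diff_le_vector_derivative[OF that expint_ratio_deriv norm_expint_kernel_le] by simp
  show ?thesis using *[of x y] *[of y x] by (cases "x \<le> y") (auto simp: norm_minus_commute)
qed

lemma expint_ratio_0: "expint_ratio 0 = 0"
  by (simp add: expint_ratio_def)

lemma continuous_on_expint_ratio: "continuous_on A expint_ratio"
  using expint_ratio_deriv by (intro continuous_at_imp_continuous_on) (auto intro: has_vector_derivative_continuous)

lemma phi_eq: "phi \<alpha> l = exp (\<alpha> * expint_ratio l)"
  by (simp add: phi_def expint_ratio_def)

text \<open>The boundary term \<open>E\<close> of one integration by parts makes the derivative of the remaining
  function \<open>J\<close> integrable at infinity.\<close>

lemma expint_ratio_log_large: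
  assumes s: "s = 1 \<or> s = (-1::real)" and y: "y \<ge> 1"
  shows "norm (expint_ratio (s * y) + of_real (ln y)) \<le> 4"
proof -
  define E where "E = (\<lambda>y. exp (\<i> * of_real s * of_real y) / (\<i> * of_real s * complex_of_real y))"
  define J where "J = (\<lambda>y. expint_ratio (s * y) + of_real (ln y) - E y)"
  have s0: "s \<noteq> 0" "\<bar>s\<bar> = 1" "of_real s * of_real s = (1::complex)" using s by auto
  have nE: "norm (E y) \<le> 1" if "y \<ge> 1" for y :: real
  proof -
    have "exp (\<i> * of_real s * of_real y) = exp (\<i> * of_real (s * y))" by (simp add: mult.assoc)
    then have "norm (exp (\<i> * of_real s * of_real y)) = 1" by (metis norm_exp_i_times)
    then show ?thesis using that s0 by (simp add: E_def norm_divide norm_mult)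
  qed
  \<comment> \<open>The comparison function -1/y has derivative 1/y^2, which is exactly the modulus
    of the derivative of \<open>J\<close>.\<close>
  have "norm (J y - J 1) \<le> (- 1 / y) - (- 1 / 1)"
  proof (cases "y = 1")
    case False
    then have y1: "1 < y" using y by simp
    show ?thesis
    proof (rule differentiable_bound_general[OF y1])
      have dE: "(E has_vector_derivative (exp (\<i> * of_real s * of_real x) / of_real x
          - exp (\<i> * of_real s * of_real x) / (\<i> * of_real s * of_real x * of_real x))) (at x)" if "x \<ge> 1" for x
        unfolding E_def
        by (rule has_vector_derivative_real_field)
           (use that s in \<open>auto intro!: derivative_eq_intros simp: field_simps\<close>)
      have dl: "((\<lambda>x. complex_of_real (ln x)) has_vector_derivative of_real (1 / x)) (at x)" if "x \<ge> 1" for x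
        using that by (intro has_vector_derivative_of_real)
           (auto intro!: derivative_eq_intros)
      have de: "((\<lambda>x. expint_ratio (s * x)) has_vector_derivative s *\<^sub>R expint_kernel (s * x)) (at x)" for x
      proof -
        have "((\<lambda>x. s * x) has_vector_derivative s) (at x)"
          by (auto simp flip: has_real_derivative_iff_has_vector_derivative intro!: derivative_eq_intros)
        from vector_diff_chain_at[OF this expint_ratio_deriv] show ?thesis by (simp add: o_def)
      qed
      define J' where "J' = (\<lambda>x. s *\<^sub>R expint_kernel (s * x) + complex_of_real (1 / x) - (exp (\<i> * of_real s * of_real x) / of_real x
          - exp (\<i> * of_real s * of_real x) / (\<i> * of_real s * of_real x * of_real x)))"
      have dJ: "(J has_vector_derivative J' x) (at x)" if "x \<ge> 1" for x
        unfolding J_def J'_def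
        by (intro has_vector_derivative_diff has_vector_derivative_add dE dl de that)
      show "(J has_vector_derivative J' x) (at x)" if "1 < x" "x < y" for x using dJ that by simp
      show "continuous_on {1..y} J"
        by (intro continuous_at_imp_continuous_on ballI has_vector_derivative_continuous[OF dJ]) auto
      show "continuous_on {1..y} (\<lambda>y. - 1 / y)" by (intro continuous_intros) auto
      show "((\<lambda>y. - 1 / y) has_vector_derivative 1 / x^2) (at x)" if "1 < x" "x < y" for x
        using that by (auto simp flip: has_real_derivative_iff_has_vector_derivative intro!: derivative_eq_intros simp: power2_eq_square)
      show "norm (J' x) \<le> 1 / x^2" if "1 < x" "x < y" for x
      proof -
        have e: "exp (\<i> * of_real s * of_real x) = exp (\<i> * of_real (s * x))" by (simp add: mult.assoc)
        have "s *\<^sub>R expint_kernel (s * x) = (exp (\<i> * of_real s * of_real x) - 1) / of_real x"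
          using that s0 by (simp add: expint_kernel_def scaleR_conv_of_real mult.assoc)
        then have "J' x = exp (\<i> * of_real s * of_real x) / (\<i> * of_real s * of_real x * of_real x)"
          by (simp add: J'_def diff_divide_distrib)
        then have "norm (J' x) = 1 / x^2"
          using that s0 unfolding e by (simp add: norm_divide norm_mult power2_eq_square)
        then show ?thesis by simp
      qed
    qed
  qed simp
  moreover have "(- 1 / y) - (- 1 / 1) \<le> 1" using y by simp
  ultimately have a: "norm (J y - J 1) \<le> 1" by linarith
  have "norm (expint_ratio s) \<le> 1" using norm_expint_ratio_diff_le[of s 0] s0 by (simp add: expint_ratio_0)
  then have b: "norm (J 1) \<le> 2" using nE[of 1] norm_triangle_ineq4[of "expint_ratio s" "E 1"] by (simp add: J_def)
  \<comment> \<open>The constant 4 collects 1 for the increment of \<open>J\<close>, 2 for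
    \<open>J 1\<close> and 1 for the boundary term.\<close>
  have "expint_ratio (s * y) + of_real (ln y) = (J y - J 1) + J 1 + E y" by (simp add: J_def)
  then show ?thesis using a b nE[OF y] norm_triangle_ineq[of "(J y - J 1) + J 1" "E y"] norm_triangle_ineq[of "J y - J 1" "J 1"]
    by simp
qed

text \<open>Shifting the logarithm to 1 + |l| makes the estimate uniform near 0. For |l| > 1 the
  shift costs at most 1, raising the constant from 4 to 5.\<close>

lemma expint_ratio_log: "norm (expint_ratio l + of_real (ln (1 + \<bar>l\<bar>))) \<le> 5"
proof (cases "\<bar>l\<bar> \<le> 1")
  case True
  have "norm (expint_ratio l) \<le> 1" using norm_expint_ratio_diff_le[of l 0] True by (simp add: expint_ratio_0)
  moreover have "0 \<le> ln (1 + \<bar>l\<bar>)" "ln (1 + \<bar>l\<bar>) \<le> 1" using True ln_add_one_self_le_self[of "\<bar>l\<bar>"] by simp_all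
  ultimately show ?thesis using norm_triangle_ineq[of "expint_ratio l" "of_real (ln (1 + \<bar>l\<bar>))"] by simp
next
  case False
  define s where "s = sgn l"
  have s: "s = 1 \<or> s = -1" "l = s * \<bar>l\<bar>" using False by (auto simp: s_def sgn_if)
  have a: "norm (expint_ratio l + of_real (ln \<bar>l\<bar>)) \<le> 4"
    using expint_ratio_log_large[OF s(1), of "\<bar>l\<bar>"] s(2) False by simp
  have "ln (1 + \<bar>l\<bar>) - ln \<bar>l\<bar> = ln ((1 + \<bar>l\<bar>) / \<bar>l\<bar>)" 
    using False by (subst ln_div) auto
  also have "(1 + \<bar>l\<bar>) / \<bar>l\<bar> = 1 + 1 / \<bar>l\<bar>" using False by (auto simp: field_simps)
  finally have "ln (1 + \<bar>l\<bar>) - ln \<bar>l\<bar> = ln (1 + 1 / \<bar>l\<bar>)" .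
  moreover have "ln (1 + 1 / \<bar>l\<bar>) \<le> 1 / \<bar>l\<bar>" "0 \<le> ln (1 + 1 / \<bar>l\<bar>)" using False by (auto intro!: ln_add_one_self_le_self)
  moreover have "1 / \<bar>l\<bar> \<le> 1" using False by simp
  ultimately have b: "\<bar>ln (1 + \<bar>l\<bar>) - ln \<bar>l\<bar>\<bar> \<le> 1" by linarith
  have "expint_ratio l + of_real (ln (1 + \<bar>l\<bar>)) = (expint_ratio l + of_real (ln \<bar>l\<bar>)) + of_real (ln (1 + \<bar>l\<bar>) - ln \<bar>l\<bar>)"
    by simp
  also have "norm \<dots> \<le> norm (expint_ratio l + of_real (ln \<bar>l\<bar>)) + norm (complex_of_real (ln (1 + \<bar>l\<bar>) - ln \<bar>l\<bar>))"
    by (rule norm_triangle_ineq)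
  finally show ?thesis using a b unfolding norm_of_real by linarith
qed

text \<open>Up to an error of modulus 5 the exponent is
  \<open>- \<alpha> * ln (1 + \<bar>l\<bar>)\<close>; its real part gives the power, the error gives
  the constant.\<close>

lemma norm_phi_le: "norm (phi \<alpha> l) \<le> exp (5 * norm \<alpha>) * (1 + \<bar>l\<bar>) powr (- Re \<alpha>)"
proof -
  define L where "L = ln (1 + \<bar>l\<bar>)"
  have "\<alpha> * expint_ratio l = \<alpha> * (expint_ratio l + of_real L) - \<alpha> * of_real L" by (simp add: algebra_simps)
  then have "Re (\<alpha> * expint_ratio l) = Re (\<alpha> * (expint_ratio l + of_real L)) - Re \<alpha> * L" by simp
  also have "Re (\<alpha> * (expint_ratio l + of_real L)) \<le> norm \<alpha> * norm (expint_ratio l + of_real L)"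
    using complex_Re_le_cmod norm_mult by metis
  also have "\<dots> \<le> norm \<alpha> * 5" using expint_ratio_log[of l] by (intro mult_left_mono) (auto simp: L_def)
  finally have "norm (phi \<alpha> l) \<le> exp (5 * norm \<alpha> - Re \<alpha> * L)" by (simp add: phi_eq)
  also have "\<dots> = exp (5 * norm \<alpha>) * (1 + \<bar>l\<bar>) powr (- Re \<alpha>)"
    by (simp add: powr_def L_def exp_diff exp_minus divide_inverse)
  finally show ?thesis .
qed

lemma continuous_on_phi: "continuous_on A (phi \<alpha>)"
  unfolding phi_eq by (intro continuous_intros continuous_on_expint_ratio)

section \<open>Mertens' second theorem and twisted prime sums\<close>

text \<open>Dividing the weight ln p / p by ln p brings sums with weight 1/p into the form that Abel
  summation handles.\<close>

lemma sum_mertens_weight_eq: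
  fixes g :: "nat \<Rightarrow> complex"
  assumes "1 \<le> M" "M \<le> n"
  shows "(\<Sum>m=Suc M..n. of_real (mertens_weight m) * (g m / of_real (ln m)))
     = (\<Sum>p\<in>primes_upto n. g p / of_nat p) - (\<Sum>p\<in>primes_upto M. g p / of_nat p)"
proof -
  define h where "h = (\<lambda>m::nat. if prime m then g m / of_nat m else 0)"
  have "(\<Sum>m=Suc M..n. of_real (mertens_weight m) * (g m / of_real (ln m))) = (\<Sum>m=Suc M..n. h m)"
    using assms by (intro sum.cong refl) (auto simp: mertens_weight_def h_def dest: prime_gt_1_nat)
  also have "\<dots> = (\<Sum>m=1..n. h m) - (\<Sum>m=1..M. h m)"
    using assms sum.ub_add_nat[of 1 M h "n - M"] by simp
  finally have *: "(\<Sum>m=Suc M..n. of_real (mertens_weight m) * (g m / of_real (ln m))) = (\<Sum>m=1..n. h m) - (\<Sum>m=1..M. h m)" .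
  have "(\<Sum>m=1..k. h m) = (\<Sum>p\<in>primes_upto k. g p / of_nat p)" for k
    unfolding h_def by (subst sum.inter_filter[symmetric]) (auto intro!: sum.cong simp: prime_gt_0_nat Suc_leI)
  with * show ?thesis by simp
qed

text \<open>Abel summation with \<open>H x = 1 / ln x\<close> and
  \<open>\<Phi> x = ln (ln x)\<close>. As \<open>H\<close> decreases, its oscillations telescope to
  at most \<open>1 / ln m\<close>, so the error terms form a Cauchy sequence with that rate.\<close>

lemma mertens_second_nat:
  obtains B K where "K > 0" "\<And>n. n \<ge> 2 \<Longrightarrow> \<bar>(\<Sum>p\<in>primes_upto n. 1 / real p) - ln (ln n) - B\<bar> \<le> K / ln n"
proof -
  obtain c where c: "c > 0" "\<And>n. n \<ge> 1 \<Longrightarrow> \<bar>(\<Sum>m=1..n. mertens_weight m) - ln n\<bar> \<le> c"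
    using mertens_first by blast
  define e where "e = (\<lambda>n. (\<Sum>p\<in>primes_upto n. 1 / real p) - ln (ln n))"
  have key: "\<bar>e n - e m\<bar> \<le> (3 * c + 1) / ln m" if mn: "2 \<le> m" "m \<le> n" for m n
  proof -
    have lm: "ln (real m) > 0" "ln (real n) \<ge> ln (real m)" using mn by auto
    have bd: "norm ((\<Sum>j=Suc m..n. of_real (mertens_weight j) * complex_of_real (1 / ln (real j))) - (of_real (ln (ln n)) - of_real (ln (ln m))))
      \<le> c * (norm (complex_of_real (1 / ln n)) + norm (complex_of_real (1 / ln m))) + (c + 1) * (\<Sum>j=m..<n. 1 / ln j - 1 / ln (Suc j))"
    proof (rule abel_summation_log_weights[OF c(2), where H = "\<lambda>x. complex_of_real (1 / ln x)" and \<Phi> = "\<lambda>x. of_real (ln (ln x))"])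
      fix x :: real assume x: "x \<ge> real m"
      have "((\<lambda>x. ln (ln x)) has_real_derivative (1 / ln x / x)) (at x)"
        using x mn by (auto intro!: derivative_eq_intros)
      from has_vector_derivative_of_real[where 'a = complex, OF this]
      show "((\<lambda>x. complex_of_real (ln (ln x))) has_vector_derivative of_real (1 / ln x) / of_real x) (at x)" by simp
    next
      fix j :: nat and x assume j: "m \<le> j" "real j \<le> x" "x \<le> real (Suc j)"
      have l: "ln (real j) > 0" "ln (real j) \<le> ln x" "ln x \<le> ln (real (Suc j))" using j mn by auto
      then have "1 / ln (real (Suc j)) \<le> 1 / ln x" "1 / ln x \<le> 1 / ln (real j)"
        by (intro divide_left_mono mult_pos_pos; linarith)+
      then have "\<bar>1 / ln (real (Suc j)) - 1 / ln x\<bar> \<le> 1 / ln (real j) - 1 / ln (real (Suc j))" by linarith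
      then show "norm (complex_of_real (1 / ln (real (Suc j))) - complex_of_real (1 / ln x)) \<le> 1 / ln (real j) - 1 / ln (real (Suc j))"
        by (simp only: norm_of_real flip: of_real_diff)
    qed (use mn in auto)
    have S: "(\<Sum>j=Suc m..n. of_real (mertens_weight j) * complex_of_real (1 / ln (real j))) = of_real ((\<Sum>p\<in>primes_upto n. 1 / real p) - (\<Sum>p\<in>primes_upto m. 1 / real p))"
      using sum_mertens_weight_eq[of m n "\<lambda>_. 1"] mn by simp
    have T: "(\<Sum>j=m..<n. 1 / ln (real j) - 1 / ln (real (Suc j))) = 1 / ln m - 1 / ln n"
      using sum_Suc_diff'[of m n "\<lambda>j. - (1 / ln (real j))"] mn by (simp add: algebra_simps)
    have "complex_of_real (e n - e m) = (\<Sum>j=Suc m..n. of_real (mertens_weight j) * complex_of_real (1 / ln (real j))) - (of_real (ln (ln n)) - of_real (ln (ln m)))"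
      unfolding S e_def by simp
    then have "\<bar>e n - e m\<bar> \<le> c * (\<bar>1 / ln n\<bar> + \<bar>1 / ln m\<bar>) + (c + 1) * (1 / ln m - 1 / ln n)"
      using bd unfolding T norm_of_real by (metis norm_of_real)
    also have "\<dots> \<le> c * (1 / ln m + 1 / ln m) + (c + 1) * (1 / ln m)"
      using lm c by (intro add_mono mult_left_mono) (auto intro!: divide_left_mono)
    also have "\<dots> = (3 * c + 1) / ln m" by (simp add: add_divide_distrib algebra_simps)
    finally show ?thesis .
  qed
  have lim0: "(\<lambda>m::nat. (3 * c + 1) / ln m) \<longlonglongrightarrow> 0" by real_asymp
  have "Cauchy e"
  proof (rule metric_CauchyI)
    fix d :: real assume "d > 0"
    then have "eventually (\<lambda>m::nat. (3 * c + 1) / ln m < d / 2) sequentially"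
      using lim0 by (intro order_tendstoD) auto
    then obtain m0 :: nat where m0: "\<And>m::nat. m \<ge> m0 \<Longrightarrow> (3 * c + 1) / ln m < d / 2" by (auto simp: eventually_sequentially)
    define q where "q = max 2 m0"
    have "dist (e m) (e n) < d" if "m \<ge> q" "n \<ge> q" for m n
    proof -
      have "\<bar>e m - e q\<bar> < d / 2" "\<bar>e n - e q\<bar> < d / 2"
        using order.strict_trans1[OF key[of q m] m0[of q]] order.strict_trans1[OF key[of q n] m0[of q]] that
        by (auto simp: q_def)
      then show ?thesis unfolding dist_real_def by linarith
    qed
    then show "\<exists>M. \<forall>m\<ge>M. \<forall>n\<ge>M. dist (e m) (e n) < d" by blast
  qed
  \<comment> \<open>\<open>B\<close> is Mertens' constant; letting \<open>n\<close> tend to infinity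
    in \<open>key\<close> turns the Cauchy estimate into the rate of convergence.\<close>
  then obtain B where B: "e \<longlonglongrightarrow> B" using Cauchy_convergent convergent_def by blast
  show ?thesis
  proof (rule that[of "3 * c + 1" B])
    show "3 * c + 1 > 0" using c by simp
    fix m :: nat assume m: "m \<ge> 2"
    have "(\<lambda>n. \<bar>e n - e m\<bar>) \<longlonglongrightarrow> \<bar>B - e m\<bar>" by (intro tendsto_intros B)
    moreover have "eventually (\<lambda>n. \<bar>e n - e m\<bar> \<le> (3 * c + 1) / ln m) sequentially"
      using eventually_ge_at_top[of m] by eventually_elim (rule key[OF m])
    ultimately have "\<bar>B - e m\<bar> \<le> (3 * c + 1) / ln m" by (intro tendsto_upperbound) auto
    then show "\<bar>(\<Sum>p\<in>primes_upto m. 1 / real p) - ln (ln m) - B\<bar> \<le> (3 * c + 1) / ln m"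
      by (simp add: e_def abs_minus_commute)
  qed
qed

text \<open>Each new term is at most the increment of \<open>ln (ln n)\<close>, by two uses of ln x
  <= x - 1. The summand 2 covers the first term, since \<open>ln (ln 2)\<close> is negative.\<close>

lemma sum_inverse_n_ln_le: "n \<ge> 2 \<Longrightarrow> (\<Sum>m=2..<Suc n. 1 / (real m * ln m)) \<le> 2 + ln (ln n)"
proof (induction n rule: dec_induct)
  case base
  have l: "ln (2::real) \<ge> 2/3" by (rule ln2_ge_two_thirds)
  have "ln (1 / ln (2::real)) \<le> 1 / ln 2 - 1" using l by (intro ln_le_minus_one) auto
  moreover have "1 / ln (2::real) \<le> 1 / (2/3)" using l by (intro divide_left_mono) auto
  ultimately have "1 / (2 * ln (2::real)) \<le> 2 + ln (ln 2)" using l by (simp add: ln_div)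
  moreover have "{2..<Suc 2} = {2::nat}" by auto
  ultimately show ?case by simp
next
  case (step n)
  define a b where "a = ln (real n)" and "b = ln (real (Suc n))"
  have ab: "a > 0" "b > 0" using step by (auto simp: a_def b_def)
  have "ln (real n / real (Suc n)) \<le> real n / real (Suc n) - 1" using step by (intro ln_le_minus_one) auto
  then have "1 / real (Suc n) \<le> b - a" using step by (simp add: a_def b_def ln_div field_simps)
  then have "1 / real (Suc n) / b \<le> (b - a) / b" using ab by (intro divide_right_mono) auto
  moreover have "ln (a / b) \<le> a / b - 1" using ab by (intro ln_le_minus_one) auto
  ultimately have "1 / (real (Suc n) * b) \<le> ln b - ln a" using ab by (simp add: ln_div diff_divide_distrib)
  then show ?case using step by (simp add: a_def b_def)
qed

text \<open>Abel summation with \<open>H x = (exp (\<i> * t * ln x) - 1) / ln x\<close> and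
  \<open>\<Phi> x = expint_ratio (t * ln x)\<close>. The derivative of \<open>H\<close> is O(|t| /
  (x ln x)), and summing this bound over the integers produces the iterated logarithm.\<close>

lemma twisted_prime_sum_nat:
  obtains K where "K > 0"
    "\<And>n t. n \<ge> 2 \<Longrightarrow> norm ((\<Sum>p\<in>primes_upto n. (exp (\<i> * of_real (t * ln p)) - 1) / of_nat p) - expint_ratio (t * ln n))
       \<le> K * \<bar>t\<bar> * (3 + ln (ln n))"
proof -
  obtain c where c: "c > 0" "\<And>n. n \<ge> 1 \<Longrightarrow> \<bar>(\<Sum>m=1..n. mertens_weight m) - ln n\<bar> \<le> c"
    using mertens_first by blast
  have main: "norm ((\<Sum>p\<in>primes_upto n. (exp (\<i> * of_real (t * ln p)) - 1) / of_nat p) - expint_ratio (t * ln n))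
       \<le> (2 * c + 2) * \<bar>t\<bar> * (3 + ln (ln n))" if n: "n \<ge> 2" for n t
  proof -
    define g where "g = (\<lambda>x. exp (\<i> * of_real (t * ln x)) - 1)"
    define H where "H = (\<lambda>x. g x / complex_of_real (ln x))"
    have ng: "norm (g x) \<le> \<bar>t\<bar> * ln x" if "x > 1" for x
      using norm_exp_ii_minus_one_le[of "t * ln x"] that by (simp add: g_def abs_mult)
    have nH: "norm (H x) \<le> \<bar>t\<bar>" if "x > 1" for x
      using ng[OF that] that by (simp add: H_def norm_divide divide_simps)
    have dlog: "((\<lambda>x. t * ln x) has_vector_derivative t / x) (at x)" if "x > 1" for x
      using that by (auto simp flip: has_real_derivative_iff_has_vector_derivative intro!: derivative_eq_intros)
    have dg: "(g has_vector_derivative (t / x) *\<^sub>R (\<i> * exp (\<i> * of_real (t * ln x)))) (at x)" if "x > 1" for x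
    proof -
      have "((\<lambda>y. exp (\<i> * of_real y) - 1) has_vector_derivative \<i> * exp (\<i> * of_real (t * ln x))) (at (t * ln x))"
        by (rule has_vector_derivative_real_field) (auto intro!: derivative_eq_intros)
      from vector_diff_chain_at[OF dlog[OF that] this] show ?thesis by (simp add: o_def g_def)
    qed
    have dil: "((\<lambda>x. complex_of_real (1 / ln x)) has_vector_derivative of_real (- 1 / (x * (ln x)^2))) (at x)" if "x > 1" for x
      using that by (intro has_vector_derivative_of_real)
        (auto intro!: derivative_eq_intros simp: power2_eq_square divide_simps)
    define H' where "H' = (\<lambda>x. g x * of_real (- 1 / (x * (ln x)^2)) + (t / x) *\<^sub>R (\<i> * exp (\<i> * of_real (t * ln x))) * of_real (1 / ln x))"
    have dH: "(H has_vector_derivative H' x) (at x)" if "x > 1" for x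
    proof -
      have "H = (\<lambda>x. g x * complex_of_real (1 / ln x))" by (auto simp: H_def)
      then show ?thesis unfolding H'_def using has_vector_derivative_mult[OF dg[OF that] dil[OF that]] by simp
    qed
    \<comment> \<open>Both terms of the product rule are at most |t| / (x ln x); for the first the
      bound on \<open>g\<close> cancels one of the two logarithms.\<close>
    have nH': "norm (H' x) \<le> 2 * \<bar>t\<bar> / (x * ln x)" if x: "x > 1" for x
    proof -
      have lx: "ln x > 0" using x by simp
      have "norm (g x * of_real (- 1 / (x * (ln x)^2))) = norm (g x) * (1 / (x * (ln x)^2))"
        using x lx by (simp add: norm_mult norm_divide norm_power)
      also have "\<dots> \<le> (\<bar>t\<bar> * ln x) * (1 / (x * (ln x)^2))" using ng[OF x] x by (intro mult_right_mono) auto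
      also have "\<dots> = \<bar>t\<bar> / (x * ln x)" using x lx by (simp add: power2_eq_square)
      finally have 1: "norm (g x * of_real (- 1 / (x * (ln x)^2))) \<le> \<bar>t\<bar> / (x * ln x)" .
      have "norm ((t / x) *\<^sub>R (\<i> * exp (\<i> * of_real (t * ln x))) * of_real (1 / ln x)) = \<bar>t\<bar> / (x * ln x)"
        using x lx unfolding norm_mult norm_scaleR norm_exp_i_times norm_of_real by simp
      with 1 show ?thesis unfolding H'_def
        using norm_triangle_ineq[of "g x * of_real (- 1 / (x * (ln x)^2))" "(t / x) *\<^sub>R (\<i> * exp (\<i> * of_real (t * ln x))) * of_real (1 / ln x)"]
        by (simp del: of_real_mult of_real_divide)
    qed
    \<comment> \<open>The summation starts beyond 2 because \<open>H\<close> is singular at 1. The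
      prime 2 and the boundary value of \<open>expint_ratio\<close> are handled separately, each
      costing at most |t|.\<close>
    have bd: "norm ((\<Sum>m=Suc 2..n. of_real (mertens_weight m) * H (real m)) - (expint_ratio (t * ln (real n)) - expint_ratio (t * ln (real 2))))
       \<le> c * (norm (H n) + norm (H (real 2))) + (c + 1) * (\<Sum>m=2..<n. 2 * \<bar>t\<bar> * (1 / (real m * ln m)))"
    proof (rule abel_summation_log_weights[OF c(2), where \<Phi> = "\<lambda>x. expint_ratio (t * ln x)"])
      fix x :: real assume "real 2 \<le> x"
      then have x: "x > 1" by simp
      have "(t / x) *\<^sub>R expint_kernel (t * ln x) = H x / of_real x"
        using x by (auto simp: expint_kernel_def H_def g_def scaleR_conv_of_real)
      then show "((\<lambda>x. expint_ratio (t * ln x)) has_vector_derivative H x / of_real x) (at x)"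
        using vector_diff_chain_at[OF dlog[OF x] expint_ratio_deriv] by (simp add: o_def)
    next
      fix m :: nat and x assume m: "2 \<le> m" "real m \<le> x" "x \<le> real (Suc m)"
      have "norm (H (real (Suc m)) - H x) \<le> (2 * \<bar>t\<bar> / (real m * ln m)) * (real (Suc m) - x)"
      proof (rule norm_diff_le_vector_derivative[OF m(3) dH])
        fix y assume y: "x \<le> y" "y \<le> real (Suc m)"
        then show "y > 1" using m by linarith
        then have "norm (H' y) \<le> 2 * \<bar>t\<bar> / (y * ln y)" by (rule nH')
        also have "\<dots> \<le> 2 * \<bar>t\<bar> / (real m * ln m)"
          using m y by (intro divide_left_mono mult_mono mult_pos_pos) auto
        finally show "norm (H' y) \<le> 2 * \<bar>t\<bar> / (real m * ln m)" .
      qed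
      also have "\<dots> \<le> (2 * \<bar>t\<bar> / (real m * ln m)) * 1" using m by (intro mult_left_mono) auto
      finally show "norm (H (real (Suc m)) - H x) \<le> 2 * \<bar>t\<bar> * (1 / (real m * ln m))" by simp
    qed (use n in auto)
    have P2: "primes_upto 2 = {2}" by (auto dest: prime_ge_2_nat)
    have S: "(\<Sum>m=Suc 2..n. of_real (mertens_weight m) * H (real m)) = (\<Sum>p\<in>primes_upto n. g p / of_nat p) - g 2 / 2"
      unfolding H_def using sum_mertens_weight_eq[of 2 n "\<lambda>m. g (real m)"] n P2 by simp
    have "(\<Sum>m=2..<n. 1 / (real m * ln m)) \<le> (\<Sum>m=2..<Suc n. 1 / (real m * ln m))"
      by (rule sum_mono2) auto
    also have "\<dots> \<le> 2 + ln (ln n)" by (rule sum_inverse_n_ln_le[OF n])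
    finally have V: "(\<Sum>m=2..<n. 2 * \<bar>t\<bar> * (1 / (real m * ln m))) \<le> 2 * \<bar>t\<bar> * (2 + ln (ln n))"
      unfolding sum_distrib_left[symmetric] by (intro mult_left_mono) auto
    have ll: "ln (ln (real n)) \<ge> - 1"
    proof -
      have "ln (2::real) \<ge> 2/3" by (rule ln2_ge_two_thirds)
      moreover have "ln (2::real) \<le> ln n" using n by simp
      ultimately have "2/3 \<le> ln (real n)" by linarith
      moreover have "ln (1 / ln (real n)) \<le> 1 / ln n - 1" using n by (intro ln_le_minus_one) auto
      moreover have "1 / ln (real n) \<le> 1 / (2/3)" using calculation n by (intro divide_left_mono) auto
      ultimately show ?thesis using n by (simp add: ln_div)
    qed
    have g2: "norm (g 2 / 2) \<le> \<bar>t\<bar>" 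
    proof -
      have "\<bar>t\<bar> * ln 2 \<le> \<bar>t\<bar> * 1" using ln_le_minus_one[of "2::real"] by (intro mult_left_mono) auto
      then show ?thesis using ng[of 2] by (simp add: norm_divide)
    qed
    have i2: "norm (expint_ratio (t * ln 2)) \<le> \<bar>t\<bar>"
    proof -
      have "\<bar>t\<bar> * ln 2 \<le> \<bar>t\<bar> * 1" using ln_le_minus_one[of "2::real"] by (intro mult_left_mono) auto
      then show ?thesis using norm_expint_ratio_diff_le[of "t * ln 2" 0] by (simp add: expint_ratio_0 abs_mult)
    qed
    have 1: "norm ((\<Sum>p\<in>primes_upto n. g p / of_nat p) - g 2 / 2 - (expint_ratio (t * ln (real n)) - expint_ratio (t * ln 2)))
       \<le> c * (\<bar>t\<bar> + \<bar>t\<bar>) + (c + 1) * (2 * \<bar>t\<bar> * (2 + ln (ln n)))"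
    proof (rule order.trans[OF bd[unfolded S, simplified of_nat_numeral]], intro add_mono mult_left_mono V)
    qed (use nH n c in auto)
    define X where "X = (\<Sum>p\<in>primes_upto n. g p / of_nat p)"
    have "norm (X - expint_ratio (t * ln (real n)))
       \<le> norm (X - g 2 / 2 - (expint_ratio (t * ln (real n)) - expint_ratio (t * ln 2)))
         + norm (g 2 / 2) + norm (expint_ratio (t * ln 2))"
      using norm_triangle_ineq4[of "X - g 2 / 2 - (expint_ratio (t * ln (real n)) - expint_ratio (t * ln 2)) + g 2 / 2" "expint_ratio (t * ln 2)"]
        norm_triangle_ineq[of "X - g 2 / 2 - (expint_ratio (t * ln (real n)) - expint_ratio (t * ln 2))" "g 2 / 2"]
      by simp
    also have "\<dots> \<le> c * (\<bar>t\<bar> + \<bar>t\<bar>) + (c + 1) * (2 * \<bar>t\<bar> * (2 + ln (ln n))) + \<bar>t\<bar> + \<bar>t\<bar>"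
      using 1 g2 i2 by (simp add: X_def)
    \<comment> \<open>The boundary terms add up to \<open>(2 * c + 2) * \<bar>t\<bar>\<close> and
      turn the 2 in front of \<open>ln (ln n)\<close> into a 3.\<close>
    also have "\<dots> = (2 * c + 2) * \<bar>t\<bar> * (3 + ln (ln n))" by (simp add: algebra_simps)
    finally show ?thesis by (simp add: g_def X_def)
  qed
  show ?thesis by (rule that[of "2 * c + 2"]) (use c main in auto)
qed

section \<open>Asymptotics of the Euler product\<close>

text \<open>Carries estimates from integers to real \<open>N\<close> at the cost of constants, using
  N <= n + 1 <= n^2 and N / n <= 2.\<close>

lemma ln_floor_bounds:
  assumes N: "N \<ge> (2::real)"
  defines "n \<equiv> nat \<lfloor>N\<rfloor>"
  shows "n \<ge> 2" "real n \<le> N" "ln N \<le> 2 * ln n" "ln (real n) \<le> ln N" "ln N - ln n \<le> 1"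
    "0 \<le> ln (ln N) - ln (ln n)" "ln (ln N) - ln (ln n) \<le> 1 / ln n"
proof -
  show n: "n \<ge> 2" "real n \<le> N" unfolding n_def using N by linarith+
  have N1: "N \<le> real n + 1" unfolding n_def using N by linarith
  have "n + 1 \<le> n * n" using n(1) by (cases n) auto
  then have "real (n + 1) \<le> real (n * n)" by (rule of_nat_mono)
  then have "N \<le> (real n)^2" using N1 by (simp add: power2_eq_square)
  then have "ln N \<le> ln ((real n)^2)" using N by (intro ln_mono) auto
  then show "ln N \<le> 2 * ln n" by (simp add: ln_realpow)
  show l: "ln (real n) \<le> ln N" using n N by simp
  have p: "ln (real n) > 0" "ln N > 0" using n N by auto
  have "ln (N / n) \<le> N / n - 1" using n N by (intro ln_le_minus_one) auto
  moreover have "N / n \<le> 2" using n N1 by (simp add: divide_simps)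
  ultimately show d: "ln N - ln n \<le> 1" using n N by (simp add: ln_div)
  show "0 \<le> ln (ln N) - ln (ln n)" using l p by simp
  have "ln (ln N / ln n) \<le> ln N / ln n - 1" using p by (intro ln_le_minus_one) auto
  also have "\<dots> = (ln N - ln n) / ln n" using p by (simp add: diff_divide_distrib)
  also have "\<dots> \<le> 1 / ln n" using d p by (intro divide_right_mono) auto
  finally show "ln (ln N) - ln (ln n) \<le> 1 / ln n" using p by (simp add: ln_div)
qed

lemma mertens_second:
  obtains B K where "K > 0"
    "\<And>N::real. N \<ge> 2 \<Longrightarrow> \<bar>(\<Sum>p\<in>primes_upto (nat \<lfloor>N\<rfloor>). 1 / real p) - ln (ln N) - B\<bar> \<le> K / ln N"
proof -
  obtain B K where K: "K > 0" "\<And>n. n \<ge> 2 \<Longrightarrow> \<bar>(\<Sum>p\<in>primes_upto n. 1 / real p) - ln (ln n) - B\<bar> \<le> K / ln n"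
    using mertens_second_nat by blast
  show ?thesis
  proof (rule that[of "2 * K + 2" B])
    fix N :: real assume N: "N \<ge> 2"
    define n where "n = nat \<lfloor>N\<rfloor>"
    note b = ln_floor_bounds[OF N, folded n_def]
    have p: "ln (real n) > 0" "ln N > 0" using b(1) N by auto
    have "1 / ln n \<le> 2 / ln N" using b(3) p by (simp add: field_simps)
    moreover have "K / ln n \<le> K * (2 / ln N)" using calculation K(1) mult_left_mono[of "1 / ln n" "2 / ln N" K] by simp
    ultimately have "\<bar>(\<Sum>p\<in>primes_upto n. 1 / real p) - ln (ln N) - B\<bar> \<le> K * (2 / ln N) + 2 / ln N"
      using K(2)[OF b(1)] b(6,7) by linarith
    then show "\<bar>(\<Sum>p\<in>primes_upto (nat \<lfloor>N\<rfloor>). 1 / real p) - ln (ln N) - B\<bar> \<le> (2 * K + 2) / ln N"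
      by (simp add: n_def add_divide_distrib mult.commute)
  qed (use K in simp)
qed

text \<open>From the threshold \<open>exp (exp 1)\<close> on one has
  \<open>ln (ln N) \<ge> 1\<close>, so constants can be absorbed into multiples of
  \<open>ln (ln N)\<close>.\<close>

lemma exp_exp_1_ge_2: "exp (exp 1) \<ge> (2::real)"
  using exp_ge_add_one_self[of "1::real"] exp_ge_add_one_self[of "exp 1::real"] by linarith

text \<open>Replacing \<open>ln n\<close> by \<open>ln N\<close> moves the argument of the
  1-Lipschitz function \<open>expint_ratio\<close> by at most |t|, and 3 + \<open>ln (ln n)\<close>
  is at most 4 \<open>ln (ln N)\<close>.\<close>

lemma twisted_prime_sum:
  obtains K where "K > 0"
    "\<And>N t. N \<ge> exp (exp 1) \<Longrightarrow> norm ((\<Sum>p\<in>primes_upto (nat \<lfloor>N\<rfloor>). (exp (\<i> * of_real (t * ln p)) - 1) / of_nat p) - expint_ratio (t * ln N))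
       \<le> K * \<bar>t\<bar> * ln (ln N)"
proof -
  obtain K where K: "K > 0"
    "\<And>n t. n \<ge> 2 \<Longrightarrow> norm ((\<Sum>p\<in>primes_upto n. (exp (\<i> * of_real (t * ln p)) - 1) / of_nat p) - expint_ratio (t * ln n))
       \<le> K * \<bar>t\<bar> * (3 + ln (ln n))"
    using twisted_prime_sum_nat by blast
  show ?thesis
  proof (rule that[of "4 * K + 1"])
    fix N t :: real assume N: "N \<ge> exp (exp 1)"
    have N2: "N \<ge> 2" using N exp_exp_1_ge_2 by linarith
    have lN: "ln N \<ge> exp 1" using N N2 by (simp add: ln_ge_iff)
    then have llN: "ln (ln N) \<ge> 1" using N2 by (simp add: ln_ge_iff)
    define n where "n = nat \<lfloor>N\<rfloor>"
    note b = ln_floor_bounds[OF N2, folded n_def]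
    define X where "X = (\<Sum>p\<in>primes_upto n. (exp (\<i> * of_real (t * ln p)) - 1) / of_nat p)"
    have "norm (X - expint_ratio (t * ln n)) \<le> K * \<bar>t\<bar> * (3 + ln (ln n))" unfolding X_def by (rule K(2)[OF b(1)])
    also have "\<dots> \<le> K * \<bar>t\<bar> * (4 * ln (ln N))" using b(6) llN K(1) by (intro mult_left_mono) auto
    finally have 1: "norm (X - expint_ratio (t * ln n)) \<le> 4 * K * \<bar>t\<bar> * ln (ln N)" by simp
    have "norm (expint_ratio (t * ln n) - expint_ratio (t * ln N)) \<le> \<bar>t * ln n - t * ln N\<bar>" by (rule norm_expint_ratio_diff_le)
    also have "\<dots> = \<bar>t\<bar> * (ln N - ln n)" using b(4) by (simp add: abs_mult flip: right_diff_distrib)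
    also have "\<dots> \<le> \<bar>t\<bar> * ln (ln N)" using b(5) llN by (intro mult_left_mono) auto
    finally have "norm (X - expint_ratio (t * ln N)) \<le> 4 * K * \<bar>t\<bar> * ln (ln N) + \<bar>t\<bar> * ln (ln N)"
      using 1 norm_triangle_ineq[of "X - expint_ratio (t * ln n)" "expint_ratio (t * ln n) - expint_ratio (t * ln N)"] by simp
    then show "norm ((\<Sum>p\<in>primes_upto (nat \<lfloor>N\<rfloor>). (exp (\<i> * of_real (t * ln p)) - 1) / of_nat p) - expint_ratio (t * ln N))
       \<le> (4 * K + 1) * \<bar>t\<bar> * ln (ln N)" by (simp add: X_def n_def algebra_simps)
  qed (use K in simp)
qed

text \<open>For |z| < 1 a logarithm of 1 + z + ... + z^(k-1), minus its linear term. For k >= 2 it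
  vanishes to second order at 0 and is therefore summable over z = \<alpha>/p.\<close>

definition log_factor :: "nat \<Rightarrow> complex \<Rightarrow> complex" where
  "log_factor k z = Ln (1 - z ^ k) - Ln (1 - z) - z"

lemma one_minus_not_in_nonpos_Reals: "norm (z::complex) < 1 \<Longrightarrow> 1 - z \<notin> \<real>\<^sub>\<le>\<^sub>0"
  using complex_Re_le_cmod[of z] by (auto simp: complex_nonpos_Reals_iff)

lemma exp_log_factor:
  assumes "norm z < 1" "k \<ge> 1"
  shows "exp (log_factor k z + z) = (\<Sum>j<k. z ^ j)"
proof -
  have z1: "z \<noteq> 1" using assms by auto
  have "norm z ^ k < 1" using assms by (intro power_less_one_iff[THEN iffD2]) auto
  then have zk: "z ^ k \<noteq> 1" by (metis norm_one norm_power order_less_irrefl)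
  have "exp (log_factor k z + z) = (1 - z ^ k) / (1 - z)"
    using z1 zk by (simp add: log_factor_def exp_diff)
  also have "\<dots> = (\<Sum>j<k. z ^ j)" using z1 by (simp add: sum_gp_strict)
  finally show ?thesis .
qed

text \<open>For k >= 2 the derivative vanishes at 0 and is O(s) on the ball of radius
  \<open>s\<close>. Keeping \<open>s\<close> in the Lipschitz constant gives the quadratic bound
  when \<open>w = 0\<close>.\<close>

lemma log_factor_lipschitz:
  assumes "k \<ge> 2" "r < 1" "s \<le> r" "norm z \<le> s" "norm w \<le> s"
  shows "norm (log_factor k z - log_factor k w) \<le> (real k + 1) / (1 - r) * s * norm (z - w)"
proof -
  define h' where "h' = (\<lambda>z::complex. - (of_nat k * z ^ (k - 1)) / (1 - z ^ k) + 1 / (1 - z) - 1)"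
  show ?thesis
  proof (rule field_differentiable_bound[of "cball 0 s" _ h'])
    fix x :: complex assume "x \<in> cball 0 s"
    then have x: "norm x \<le> s" by simp
    then have x1: "norm x < 1" using assms by linarith
    have s0: "s \<ge> 0" using x norm_ge_zero[of x] by linarith
    have "norm x ^ k \<le> norm x ^ 1" using assms x1 by (intro power_decreasing) auto
    then have xk: "norm (x ^ k) \<le> norm x" by (simp add: norm_power)
    then have xk1: "norm (x ^ k) < 1" using x1 by linarith
    show "(log_factor k has_field_derivative h' x) (at x within cball 0 s)"
      unfolding log_factor_def h'_def using one_minus_not_in_nonpos_Reals[OF x1] one_minus_not_in_nonpos_Reals[OF xk1]
      by (auto intro!: derivative_eq_intros simp: inverse_eq_divide)
    have a: "norm (1 - x) \<ge> 1 - r" "norm (1 - x ^ k) \<ge> 1 - r"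
      using norm_triangle_ineq2[of 1 x] norm_triangle_ineq2[of 1 "x ^ k"] x xk assms by auto
    have "norm x ^ (k - 1) \<le> norm x ^ 1" using assms x1 by (intro power_decreasing) auto
    then have "norm (- (of_nat k * x ^ (k - 1)) / (1 - x ^ k)) \<le> real k * s / (1 - r)"
      unfolding norm_divide norm_minus_cancel norm_mult norm_of_nat norm_power[of x]
      using a assms x s0 by (intro frac_le mult_left_mono) auto
    \<comment> \<open>Removing the linear term from the logarithm is what makes this part of the
      derivative small.\<close>
    moreover have "1 / (1 - x) - 1 = x / (1 - x)" using x1 by (auto simp: divide_simps)
    moreover have "norm (x / (1 - x)) \<le> s / (1 - r)"
      unfolding norm_divide using a assms x s0 by (intro frac_le) auto
    moreover have "h' x = - (of_nat k * x ^ (k - 1)) / (1 - x ^ k) + (1 / (1 - x) - 1)" by (simp add: h'_def)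
    ultimately have "norm (h' x) \<le> real k * s / (1 - r) + s / (1 - r)"
      using norm_triangle_mono by metis
    also have "\<dots> = (real k + 1) / (1 - r) * s" by (simp add: add_divide_distrib algebra_simps)
    finally show "norm (h' x) \<le> (real k + 1) / (1 - r) * s" .
  qed (use assms in auto)
qed

lemma log_factor_0: "k \<ge> 1 \<Longrightarrow> log_factor k 0 = 0" by (cases k) (simp_all add: log_factor_def)

text \<open>Telescoping, since 1/m^2 <= 1/(m - 1) - 1/m.\<close>

lemma sum_inverse_squares_tail:
  assumes "1 \<le> n" "n \<le> N"
  shows "(\<Sum>m=Suc n..N. 1 / (real m)^2) \<le> 1 / n - 1 / N"
  using assms(2)
proof (induction N rule: dec_induct)
  case (step N)
  have "1 / (real (Suc N))^2 \<le> 1 / N - 1 / real (Suc N)"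
    using step assms(1) by (simp add: divide_simps power2_eq_square)
  then show ?case using step by simp
qed simp

text \<open>The Euler product, over primes up to \<open>n\<close>, of the Dirichlet series with
  coefficients \<alpha>^\<Omega>(m) on the k-free integers m, taken at 1 - i t.\<close>

definition euler_factors :: "nat \<Rightarrow> complex \<Rightarrow> nat \<Rightarrow> real \<Rightarrow> complex" where
  "euler_factors k \<alpha> n t = (\<Prod>p\<in>primes_upto n. \<Sum>j<k. (\<alpha> * exp (\<i> * of_real (t * ln p)) / of_nat p) ^ j)"

text \<open>\<open>H\<close> is the full sum over all primes at \<open>t = 0\<close>. Cutting it at
  \<open>n\<close> costs the tail of the sum of 1/m^2, and passing to general \<open>t\<close> costs
  |t| times the sum of ln p / p^2.\<close>

lemma sum_log_factor:
  assumes k: "k \<ge> 2" and \<alpha>: "norm \<alpha> < 2"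
  obtains K H where "K > 0"
    "\<And>n t. n \<ge> 1 \<Longrightarrow> norm ((\<Sum>p\<in>primes_upto n. log_factor k (\<alpha> * exp (\<i> * of_real (t * ln p)) / of_nat p)) - H) \<le> K * (1 / n + \<bar>t\<bar>)"
proof -
  \<comment> \<open>The smallest prime is 2, so |\<alpha>| < 2 keeps all arguments \<alpha>/p in a
    disc of radius \<open>r < 1\<close>.\<close>
  define r where "r = norm \<alpha> / 2"
  have r: "r < 1" "0 \<le> r" using \<alpha> by (auto simp: r_def)
  define D where "D = (real k + 1) / (1 - r)"
  have D: "D > 0" using r by (simp add: D_def)
  define a where "a = norm \<alpha>"
  define f where "f = (\<lambda>m::nat. if prime m then log_factor k (\<alpha> / of_nat m) else 0)"
  have fb: "norm (f m) \<le> D * a^2 * (1 / (real m)^2)" for m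
  proof (cases "prime m")
    case True
    then have m: "real m \<ge> 2" using prime_ge_2_nat by force
    have am: "a / m \<le> r" unfolding r_def a_def using m by (intro divide_left_mono) auto
    have "norm (log_factor k (\<alpha> / of_nat m) - log_factor k 0) \<le> D * (a / m) * norm (\<alpha> / of_nat m - 0)"
      unfolding D_def
      by (rule log_factor_lipschitz[OF k r(1)]) (use am m in \<open>auto simp: a_def r_def norm_divide\<close>)
    then show ?thesis using k True by (simp add: f_def log_factor_0 norm_divide a_def power2_eq_square)
  qed (use D in \<open>auto simp: f_def\<close>)
  have sf: "summable f"
    by (rule summable_comparison_test'[of "\<lambda>m. D * a^2 * (1 / (real m)^2)" 0])
       (use fb summable_mult[OF inverse_power_summable[of 2, where 'a = real], of "D * a^2"] in \<open>auto simp: inverse_eq_divide\<close>)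
  define H where "H = suminf f"
  have lim: "(\<lambda>N. (\<Sum>m\<le>N. f m)) \<longlonglongrightarrow> H" unfolding H_def by (rule summable_LIMSEQ'[OF sf])
  have f0: "(\<Sum>m\<le>n. f m) = (\<Sum>p\<in>primes_upto n. log_factor k (\<alpha> / of_nat p))" for n
    unfolding f_def by (subst sum.inter_filter[symmetric]) (auto intro!: sum.cong)
  have tail: "norm ((\<Sum>m\<le>n. f m) - H) \<le> D * a^2 * (1 / n)" if n: "n \<ge> 1" for n
  proof -
    have "(\<lambda>N. (\<Sum>m\<le>N. f m) - (\<Sum>m\<le>n. f m)) \<longlonglongrightarrow> H - (\<Sum>m\<le>n. f m)" by (intro tendsto_intros lim)
    moreover have "eventually (\<lambda>N. norm ((\<Sum>m\<le>N. f m) - (\<Sum>m\<le>n. f m)) \<le> D * a^2 * (1 / n)) sequentially"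
      using eventually_ge_at_top[of n]
    proof eventually_elim
      case (elim N)
      have "{..N} - {..n} = {Suc n..N}" by auto
      then have "(\<Sum>m\<le>N. f m) - (\<Sum>m\<le>n. f m) = (\<Sum>m=Suc n..N. f m)"
        using sum_diff[of "{..N}" "{..n}" f] elim by simp
      also have "norm \<dots> \<le> (\<Sum>m=Suc n..N. D * a^2 * (1 / (real m)^2))" by (rule sum_norm_le) (rule fb)
      also have "\<dots> = D * a^2 * (\<Sum>m=Suc n..N. 1 / (real m)^2)" by (simp only: sum_distrib_left)
      also have "\<dots> \<le> D * a^2 * (1 / n)"
        using sum_inverse_squares_tail[OF n elim] D by (intro mult_left_mono) (auto intro: order.trans)
      finally show ?case .
    qed
    ultimately have "norm (H - (\<Sum>m\<le>n. f m)) \<le> D * a^2 * (1 / n)" by (intro Lim_norm_ubound) auto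
    then show ?thesis by (simp add: norm_minus_commute)
  qed
  obtain c where c: "\<And>n. (\<Sum>p\<in>primes_upto n. ln p / p^2) \<le> c"
    using sum_primes_ln_over_square by blast
  have c0: "c \<ge> 0" using c[of 0] by simp
  have dif: "norm ((\<Sum>p\<in>primes_upto n. log_factor k (\<alpha> * exp (\<i> * of_real (t * ln p)) / of_nat p)) - (\<Sum>p\<in>primes_upto n. log_factor k (\<alpha> / of_nat p)))
      \<le> D * a^2 * \<bar>t\<bar> * c" for n t
  proof -
    have "norm (\<Sum>p\<in>primes_upto n. log_factor k (\<alpha> * exp (\<i> * of_real (t * ln p)) / of_nat p) - log_factor k (\<alpha> / of_nat p))
      \<le> (\<Sum>p\<in>primes_upto n. D * a^2 * \<bar>t\<bar> * (ln p / p^2))"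
    proof (rule sum_norm_le)
      fix p assume "p \<in> primes_upto n"
      then have p: "real p \<ge> 2" using prime_ge_2_nat by force
      have am: "a / p \<le> r" unfolding r_def a_def using p by (intro divide_left_mono) auto
      have "norm (log_factor k (\<alpha> * exp (\<i> * of_real (t * ln p)) / of_nat p) - log_factor k (\<alpha> / of_nat p))
         \<le> D * (a / p) * norm (\<alpha> * exp (\<i> * of_real (t * ln p)) / of_nat p - \<alpha> / of_nat p)"
        unfolding D_def
        by (rule log_factor_lipschitz[OF k r(1)])
           (use p am in \<open>auto simp: a_def norm_divide norm_mult simp del: of_real_mult\<close>)
      also have "\<alpha> * exp (\<i> * of_real (t * ln p)) / of_nat p - \<alpha> / of_nat p = \<alpha> / of_nat p * (exp (\<i> * of_real (t * ln p)) - 1)"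
        by (simp add: algebra_simps)
      also have "norm \<dots> = a / p * norm (exp (\<i> * of_real (t * ln p)) - 1)"
        unfolding norm_mult norm_divide a_def by simp
      also have "D * (a / p) * (a / p * norm (exp (\<i> * of_real (t * ln p)) - 1)) \<le> D * (a / p) * (a / p * \<bar>t * ln p\<bar>)"
        using D by (intro mult_left_mono norm_exp_ii_minus_one_le) (auto simp: a_def)
      also have "\<dots> = D * a^2 * \<bar>t\<bar> * (ln p / p^2)" using p by (simp add: abs_mult power2_eq_square)
      finally show "norm (log_factor k (\<alpha> * exp (\<i> * of_real (t * ln p)) / of_nat p) - log_factor k (\<alpha> / of_nat p)) \<le> D * a^2 * \<bar>t\<bar> * (ln p / p^2)" .
    qed
    also have "\<dots> \<le> D * a^2 * \<bar>t\<bar> * c"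
      unfolding sum_distrib_left[symmetric] using D c by (intro mult_left_mono) auto
    finally show ?thesis by (simp add: sum_subtractf)
  qed
  show ?thesis
  \<comment> \<open>The added 1 keeps the constant positive when \<alpha> = 0.\<close>
  proof (rule that[of "D * a^2 * (c + 1) + 1" H])
    show "D * a^2 * (c + 1) + 1 > 0" using D c0 by (intro add_nonneg_pos mult_nonneg_nonneg) auto
    fix n t assume n: "(n::nat) \<ge> 1"
    have "norm ((\<Sum>p\<in>primes_upto n. log_factor k (\<alpha> * exp (\<i> * of_real (t * ln p)) / of_nat p)) - H) \<le> D * a^2 * \<bar>t\<bar> * c + D * a^2 * (1 / n)"
      using dif[of t n] tail[OF n, unfolded f0]
        norm_triangle_ineq[of "(\<Sum>p\<in>primes_upto n. log_factor k (\<alpha> * exp (\<i> * of_real (t * ln p)) / of_nat p)) - (\<Sum>p\<in>primes_upto n. log_factor k (\<alpha> / of_nat p))"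
          "(\<Sum>p\<in>primes_upto n. log_factor k (\<alpha> / of_nat p)) - H"] by simp
    also have "\<dots> \<le> (D * a^2 * (c + 1) + 1) * (1 / n + \<bar>t\<bar>)"
      using D c0 by (simp add: algebra_simps)
    finally show "norm ((\<Sum>p\<in>primes_upto n. log_factor k (\<alpha> * exp (\<i> * of_real (t * ln p)) / of_nat p)) - H) \<le> (D * a^2 * (c + 1) + 1) * (1 / n + \<bar>t\<bar>)" .
  qed
qed

text \<open>The logarithm of the product has three parts: the second-order terms, tending to
  \<open>H\<close>; \<alpha> times the sum of 1/p, giving \<open>log_power\<close> and Mertens'
  constant; and \<alpha> times the twisted sum, giving \<open>phi\<close>. Their errors
  \<open>d1\<close>, \<open>d2\<close>, \<open>d3\<close> stay in the exponent because
  \<open>d\<close> need not be small.\<close>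

lemma euler_factors_asymptotics:
  assumes k: "k \<ge> 2" and \<alpha>: "norm \<alpha> < 2"
  obtains C K where "C \<noteq> 0" "K > 0"
    "\<And>N l. N \<ge> exp (exp 1) \<Longrightarrow> \<exists>d. euler_factors k \<alpha> (nat \<lfloor>N\<rfloor>) (l / ln N) = C * log_power N \<alpha> * phi \<alpha> l * exp d
        \<and> norm d \<le> K * (1 + \<bar>l\<bar>) * (ln (ln N) / ln N)"
proof -
  obtain K1 H where K1: "K1 > 0"
    "\<And>n t. n \<ge> 1 \<Longrightarrow> norm ((\<Sum>p\<in>primes_upto n. log_factor k (\<alpha> * exp (\<i> * of_real (t * ln p)) / of_nat p)) - H) \<le> K1 * (1 / n + \<bar>t\<bar>)"
    using sum_log_factor[OF k \<alpha>] by blast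
  obtain B K2 where K2: "K2 > 0"
    "\<And>N::real. N \<ge> 2 \<Longrightarrow> \<bar>(\<Sum>p\<in>primes_upto (nat \<lfloor>N\<rfloor>). 1 / real p) - ln (ln N) - B\<bar> \<le> K2 / ln N"
    using mertens_second by blast
  obtain K3 where K3: "K3 > 0"
    "\<And>N t. N \<ge> exp (exp 1) \<Longrightarrow> norm ((\<Sum>p\<in>primes_upto (nat \<lfloor>N\<rfloor>). (exp (\<i> * of_real (t * ln p)) - 1) / of_nat p) - expint_ratio (t * ln N))
       \<le> K3 * \<bar>t\<bar> * ln (ln N)"
    using twisted_prime_sum by blast
  define C where "C = exp (\<alpha> * of_real B + H)"
  \<comment> \<open>The 2 at \<open>K1\<close> comes from 1/n <= 2u, those at \<open>K2\<close> and
    \<open>K3\<close> from |\<alpha>| < 2.\<close>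
  define K where "K = 2 * K1 + 2 * K2 + 2 * K3"
  have Kp: "K > 0" using K1 K2 K3 by (simp add: K_def)
  show ?thesis
  proof (rule that[of C K])
    show "C \<noteq> 0" by (simp add: C_def)
    show "K > 0" by fact
    fix N l :: real assume N: "N \<ge> exp (exp 1)"
    have N2: "N \<ge> 2" using N exp_exp_1_ge_2 by linarith
    have lN: "ln N \<ge> exp 1" using N N2 by (simp add: ln_ge_iff)
    then have llN: "ln (ln N) \<ge> 1" using N2 by (simp add: ln_ge_iff)
    have lN0: "ln N > 0" using N2 by simp
    define n where "n = nat \<lfloor>N\<rfloor>"
    define t where "t = l / ln N"
    note b = ln_floor_bounds[OF N2, folded n_def]
    define z where "z = (\<lambda>p::nat. \<alpha> * exp (\<i> * of_real (t * ln p)) / of_nat p)"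
    define d1 where "d1 = (\<Sum>p\<in>primes_upto n. log_factor k (z p)) - H"
    define d2 where "d2 = (\<Sum>p\<in>primes_upto n. 1 / real p) - ln (ln N) - B"
    define d3 where "d3 = (\<Sum>p\<in>primes_upto n. (exp (\<i> * of_real (t * ln p)) - 1) / of_nat p) - expint_ratio (t * ln N)"
    define d where "d = d1 + \<alpha> * of_real d2 + \<alpha> * d3"
    have zp: "norm (z p) < 1" if "prime p" for p
    proof -
      have "real p \<ge> 2" using prime_ge_2_nat[OF that] by simp
      then show ?thesis using \<alpha> unfolding z_def norm_divide norm_mult norm_exp_i_times by simp
    qed
    have "euler_factors k \<alpha> n t = (\<Prod>p\<in>primes_upto n. exp (log_factor k (z p) + z p))"
      unfolding euler_factors_def
    proof (intro prod.cong refl)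
      fix p assume "p \<in> primes_upto n"
      then show "(\<Sum>j<k. (\<alpha> * exp (\<i> * of_real (t * ln p)) / of_nat p) ^ j) = exp (log_factor k (z p) + z p)"
        using exp_log_factor[of "z p" k] zp[of p] k unfolding z_def by simp
    qed
    also have "\<dots> = exp ((\<Sum>p\<in>primes_upto n. log_factor k (z p)) + (\<Sum>p\<in>primes_upto n. z p))"
      by (simp add: exp_sum[OF finite_primes_upto] sum.distrib[symmetric])
    \<comment> \<open>Writing p^(it) as 1 + (p^(it) - 1) separates the divergent sum of 1/p from the
      twisted sum.\<close>
    also have "(\<Sum>p\<in>primes_upto n. z p) = \<alpha> * of_real (\<Sum>p\<in>primes_upto n. 1 / real p) + \<alpha> * (\<Sum>p\<in>primes_upto n. (exp (\<i> * of_real (t * ln p)) - 1) / of_nat p)"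
      unfolding z_def of_real_sum sum_distrib_left sum.distrib[symmetric]
      by (intro sum.cong refl) (simp add: diff_divide_distrib algebra_simps)
    also have "(\<Sum>p\<in>primes_upto n. log_factor k (z p)) = H + d1" by (simp add: d1_def)
    also have "(\<Sum>p\<in>primes_upto n. 1 / real p) = d2 + ln (ln N) + B" by (simp add: d2_def)
    also have "(\<Sum>p\<in>primes_upto n. (exp (\<i> * of_real (t * ln p)) - 1) / of_nat p) = d3 + expint_ratio l" 
      using lN0 by (simp add: d3_def t_def)
    also have "H + d1 + (\<alpha> * of_real (d2 + ln (ln N) + B) + \<alpha> * (d3 + expint_ratio l))
      = (\<alpha> * of_real B + H) + \<alpha> * of_real (ln (ln N)) + \<alpha> * expint_ratio l + d"
      by (simp add: d_def algebra_simps)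
    finally have eq: "euler_factors k \<alpha> n t = C * log_power N \<alpha> * phi \<alpha> l * exp d"
      by (simp add: exp_add C_def log_power_def phi_eq)
    define u where "u = ln (ln N) / ln N"
    have u: "1 / ln N \<le> u" "u > 0" unfolding u_def
      using divide_right_mono[OF llN, of "ln N"] divide_pos_pos[of "ln (ln N)" "ln N"] llN lN0 by linarith+
    have tu: "\<bar>t\<bar> \<le> \<bar>l\<bar> * u" using mult_left_mono[OF u(1), of "\<bar>l\<bar>"] lN0 by (simp add: t_def abs_divide)
    have "real n \<ge> ln N / 2" using b(1,3) ln_le_minus_one[of "real n"] by auto
    then have "1 / n \<le> 1 / (ln N / 2)" using lN0 b(1) by (intro divide_left_mono mult_pos_pos) auto
    then have nu: "1 / n \<le> 2 * u" using u(1) by simp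
    have "norm d1 \<le> K1 * (1 / n + \<bar>t\<bar>)" unfolding d1_def z_def by (rule K1(2)) (use b(1) in auto)
    also have "\<dots> \<le> K1 * (2 * u + \<bar>l\<bar> * u)" using K1(1) nu tu by (intro mult_left_mono) auto
    also have "\<dots> \<le> 2 * K1 * (1 + \<bar>l\<bar>) * u" using K1(1) u by (simp add: algebra_simps)
    finally have 1: "norm d1 \<le> 2 * K1 * (1 + \<bar>l\<bar>) * u" .
    have "\<bar>d2\<bar> \<le> K2 / ln N" unfolding d2_def n_def by (rule K2(2)[OF N2])
    also have "\<dots> \<le> K2 * u" using mult_left_mono[OF u(1), of K2] K2(1) by simp
    also have "\<dots> \<le> K2 * (1 + \<bar>l\<bar>) * u" using K2(1) u by (simp add: algebra_simps)
    finally have "norm \<alpha> * \<bar>d2\<bar> \<le> 2 * (K2 * (1 + \<bar>l\<bar>) * u)" using \<alpha> by (intro mult_mono) auto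
    then have 2: "norm (\<alpha> * of_real d2) \<le> 2 * K2 * (1 + \<bar>l\<bar>) * u" by (simp add: norm_mult)
    have "norm d3 \<le> K3 * \<bar>t\<bar> * ln (ln N)" unfolding d3_def n_def by (rule K3(2)[OF N])
    also have "\<dots> = K3 * \<bar>l\<bar> * u" using lN0 by (simp add: t_def u_def abs_divide)
    also have "\<dots> \<le> K3 * (1 + \<bar>l\<bar>) * u" using K3(1) u by (simp add: algebra_simps)
    finally have "norm \<alpha> * norm d3 \<le> 2 * (K3 * (1 + \<bar>l\<bar>) * u)" using \<alpha> by (intro mult_mono) auto
    then have 3: "norm (\<alpha> * d3) \<le> 2 * K3 * (1 + \<bar>l\<bar>) * u" by (simp add: norm_mult)
    have "norm d \<le> norm d1 + norm (\<alpha> * of_real d2) + norm (\<alpha> * d3)"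
      unfolding d_def by (rule order.trans[OF norm_triangle_ineq]) (intro add_right_mono norm_triangle_ineq)
    also have "\<dots> \<le> K * (1 + \<bar>l\<bar>) * u" using 1 2 3 by (simp add: K_def algebra_simps)
    finally show "\<exists>d. euler_factors k \<alpha> (nat \<lfloor>N\<rfloor>) (l / ln N) = C * log_power N \<alpha> * phi \<alpha> l * exp d
        \<and> norm d \<le> K * (1 + \<bar>l\<bar>) * (ln (ln N) / ln N)"
      using eq unfolding n_def t_def u_def by blast
  qed
qed

section \<open>Euler product and Fourier uniqueness\<close>

text \<open>Unique factorization: being k-free says that all exponents are below \<open>k\<close>,
  being smooth says that only primes in \<open>P\<close> occur.\<close>

lemma kfree_smooth_bij:
  fixes P :: "nat set"
  assumes k: "k \<ge> 1" and P: "P = {p. prime p \<and> real p \<le> N}" and fin: "finite P"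
  shows "bij_betw (\<lambda>e. \<Prod>p\<in>P. p ^ e p) (PiE P (\<lambda>_. {..<k})) (kfree_smooth k N)"
proof (rule bij_betwI[where g = "\<lambda>n. restrict (\<lambda>p. multiplicity p n) P"])
  have mult: "multiplicity q (\<Prod>p\<in>P. p ^ e p) = (if q \<in> P then e q else 0)" if "prime q" for q e
    using multiplicity_prod_prime_powers[OF fin, of q e] that P by auto
  have pos: "(\<Prod>p\<in>P. p ^ e p) \<ge> 1" for e :: "nat \<Rightarrow> nat"
  proof -
    have "(\<Prod>p\<in>P. p ^ e p) > 0" unfolding P by (intro prod_pos) (auto simp: prime_gt_0_nat)
    then show ?thesis by linarith
  qed
  show "(\<lambda>e. \<Prod>p\<in>P. p ^ e p) \<in> PiE P (\<lambda>_. {..<k}) \<rightarrow> kfree_smooth k N"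
  proof
    fix e assume e: "e \<in> PiE P (\<lambda>_. {..<k})"
    define n where "n = (\<Prod>p\<in>P. p ^ e p)"
    have "\<not> q ^ k dvd n" if q: "prime q" for q
    proof
      assume "q ^ k dvd n"
      then have "k \<le> multiplicity q n" using pos[of e] q unfolding n_def by (intro multiplicity_geI) auto
      then show False using mult[OF q, of e] PiE_mem[OF e, of q] k by (auto simp: n_def split: if_splits)
    qed
    moreover have "real q \<le> N" if q: "prime q" "q dvd n" for q
    proof -
      have "multiplicity q n > 0" using q pos[of e] by (auto simp: n_def prime_multiplicity_gt_zero_iff)
      then show ?thesis using mult[OF q(1), of e] P by (auto simp: n_def split: if_splits)
    qed
    ultimately show "(\<Prod>p\<in>P. p ^ e p) \<in> kfree_smooth k N"
      using pos[of e] by (auto simp: kfree_smooth_def kfree_def n_def)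
  qed
  show "(\<lambda>n. restrict (\<lambda>p. multiplicity p n) P) \<in> kfree_smooth k N \<rightarrow> PiE P (\<lambda>_. {..<k})"
  proof
    fix n assume n: "n \<in> kfree_smooth k N"
    have "multiplicity p n < k" if "prime p" for p
      using n that multiplicity_dvd'[of k p n] by (force simp: kfree_smooth_def kfree_def)
    then show "restrict (\<lambda>p. multiplicity p n) P \<in> PiE P (\<lambda>_. {..<k})" using P by auto
  qed
  show "restrict (\<lambda>q. multiplicity q (\<Prod>p\<in>P. p ^ e p)) P = e" if "e \<in> PiE P (\<lambda>_. {..<k})" for e
    using that mult P by (auto simp: fun_eq_iff PiE_def extensional_def)
  show "(\<Prod>p\<in>P. p ^ restrict (\<lambda>p. multiplicity p n) P p) = n" if n: "n \<in> kfree_smooth k N" for n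
  proof -
    have n0: "n \<noteq> 0" using n by (auto simp: kfree_smooth_def kfree_def)
    have sub: "prime_factors n \<subseteq> P" using n P by (auto simp: kfree_smooth_def prime_factors_dvd)
    have "n = (\<Prod>p\<in>prime_factors n. p ^ multiplicity p n)" using n0 by (simp add: prime_factorization_nat)
    also have "\<dots> = (\<Prod>p\<in>P. p ^ multiplicity p n)"
      by (rule prod.mono_neutral_left[OF fin sub]) (use P in \<open>auto simp: prime_factors_multiplicity\<close>)
    finally show ?thesis by simp
  qed
qed

text \<open>Expanding the product of finite sums gives one term for each exponent vector.
  Multiplicativity is stated for positive arguments, where \<open>ln\<close> and
  \<open>bigomega\<close> turn products into sums.\<close>

lemma euler_product_kfree_smooth:
  fixes g :: "nat \<Rightarrow> complex"
  assumes k: "k \<ge> 1" and N: "N \<ge> 0" and g1: "g 1 = 1" and gm: "\<And>a b. a > 0 \<Longrightarrow> b > 0 \<Longrightarrow> g (a * b) = g a * g b"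
  shows "(\<Sum>n\<in>kfree_smooth k N. g n) = (\<Prod>p\<in>primes_upto (nat \<lfloor>N\<rfloor>). \<Sum>j<k. g p ^ j)"
proof -
  define P where "P = primes_upto (nat \<lfloor>N\<rfloor>)"
  have P: "P = {p. prime p \<and> real p \<le> N}" unfolding P_def using N by (auto simp: le_nat_iff le_floor_iff)
  have fin: "finite P" unfolding P_def by (rule finite_primes_upto)
  have gp: "g (p ^ j) = g p ^ j" if "p > 0" for p j using that g1 gm by (induction j) auto
  have gprod: "g (\<Prod>p\<in>A. p ^ e p) = (\<Prod>p\<in>A. g p ^ e p)" if "finite A" "A \<subseteq> P" for A and e :: "nat \<Rightarrow> nat"
    using that
  proof (induction A rule: finite_induct)
    case (insert x F)
    have "x > 0" "(\<Prod>p\<in>F. p ^ e p) > 0" using insert P by (auto intro!: prod_pos simp: prime_gt_0_nat)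
    then show ?case using insert gm gp by simp
  qed (use g1 in auto)
  have "(\<Sum>n\<in>kfree_smooth k N. g n) = (\<Sum>e\<in>PiE P (\<lambda>_. {..<k}). g (\<Prod>p\<in>P. p ^ e p))"
    by (rule sum.reindex_bij_betw[OF kfree_smooth_bij[OF k P fin], symmetric])
  also have "\<dots> = (\<Sum>e\<in>PiE P (\<lambda>_. {..<k}). \<Prod>p\<in>P. g p ^ e p)"
    using gprod[OF fin order_refl] by simp
  also have "\<dots> = (\<Prod>p\<in>P. \<Sum>j<k. g p ^ j)" by (rule prod_sum_PiE[symmetric]) (use fin in auto)
  finally show ?thesis by (simp add: P_def)
qed

lemma bigomega_mult: "a > 0 \<Longrightarrow> b > 0 \<Longrightarrow> bigomega (a * b) = bigomega a + bigomega b"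
  by (simp add: bigomega_def prime_factorization_mult)

lemma bigomega_prime: "prime p \<Longrightarrow> bigomega p = 1"
  by (simp add: bigomega_def prime_factorization_prime)

section \<open>Uniqueness of the Fourier transform\<close>

lemma real_distribution_density:
  fixes u :: "real \<Rightarrow> real"
  assumes "integrable lborel u" "\<And>x. u x \<ge> 0" "integral\<^sup>L lborel u = 1"
  shows "real_distribution (density lborel (\<lambda>x. ennreal (u x)))"
proof -
  have m: "u \<in> borel_measurable borel" using assms(1) by auto
  have "(\<integral>\<^sup>+x. ennreal (u x) \<partial>lborel) = ennreal 1" 
    using nn_integral_eq_integral[OF assms(1)] assms by simp
  then have "emeasure (density lborel (\<lambda>x. ennreal (u x))) (space (density lborel (\<lambda>x. ennreal (u x)))) = 1"
    using m by (simp add: emeasure_density cong: nn_integral_cong)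
  then show ?thesis
    by (intro real_distribution.intro real_distribution_axioms.intro prob_spaceI) auto
qed

text \<open>Evaluating at \<open>x = 0\<close> shows that both functions have the same mass
  \<open>m\<close>. If \<open>m > 0\<close>, division by \<open>m\<close> gives probability
  densities with equal characteristic functions; if \<open>m = 0\<close>, both vanish almost
  everywhere.\<close>

lemma nonneg_fourier_unique:
  fixes u v :: "real \<Rightarrow> real"
  assumes u: "integrable lborel u" "\<And>x. u x \<ge> 0" and v: "integrable lborel v" "\<And>x. v x \<ge> 0"
    and eq: "\<And>x. (LINT l|lborel. of_real (u l) * exp (\<i> * of_real l * of_real x)) = (LINT l|lborel. of_real (v l) * exp (\<i> * of_real l * of_real x))"
  shows "AE x in lborel. u x = v x"
proof -
  define m where "m = integral\<^sup>L lborel u"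
  have meas: "u \<in> borel_measurable borel" "v \<in> borel_measurable borel" using u v by auto
  have "complex_of_real (integral\<^sup>L lborel u) = complex_of_real (integral\<^sup>L lborel v)"
    using eq[of 0] by simp
  then have mv: "integral\<^sup>L lborel v = m" by (simp add: m_def)
  show ?thesis
  proof (cases "m = 0")
    case True
    have "AE x in lborel. u x = 0" using integral_nonneg_eq_0_iff_AE[OF u(1)] u(2) True by (simp add: m_def)
    moreover have "AE x in lborel. v x = 0" using integral_nonneg_eq_0_iff_AE[OF v(1)] v(2) True mv by simp
    ultimately show ?thesis by eventually_elim simp
  next
    case False
    have m0: "m > 0" using False integral_nonneg_AE[of u lborel] u(2) unfolding m_def by (simp add: order_less_le)
    define U where "U = density lborel (\<lambda>x. ennreal (u x / m))"
    define V where "V = density lborel (\<lambda>x. ennreal (v x / m))"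
    have dU: "real_distribution U" unfolding U_def
      by (rule real_distribution_density) (use u m0 in \<open>auto simp: m_def\<close>)
    have dV: "real_distribution V" unfolding V_def
      by (rule real_distribution_density) (use v m0 mv in auto)
    have ch: "char (density lborel (\<lambda>x. ennreal (w x / m))) t = (LINT l|lborel. of_real (w l) * exp (\<i> * of_real l * of_real t)) / of_real m"
      if w: "w \<in> borel_measurable borel" "\<And>x. w x \<ge> 0" for w t
    proof -
      have "char (density lborel (\<lambda>x. ennreal (w x / m))) t = (LINT l|lborel. (w l / m) *\<^sub>R iexp (t * l))"
        unfolding char_def using w m0 by (intro integral_density) auto
      also have "\<dots> = (LINT l|lborel. (of_real (w l) * exp (\<i> * of_real l * of_real t)) / of_real m)"
        by (intro Bochner_Integration.integral_cong refl) (simp add: scaleR_conv_of_real mult_ac)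
      finally show ?thesis by simp
    qed
    have "char U = char V" unfolding U_def V_def using ch[OF meas(1) u(2)] ch[OF meas(2) v(2)] eq by (auto simp: fun_eq_iff)
    then have "U = V" by (rule Levy_uniqueness[OF dU dV])
    then have "AE x in lborel. ennreal (u x / m) = ennreal (v x / m)"
      unfolding U_def V_def using meas by (intro sigma_finite_measure.density_unique lborel.sigma_finite_measure_axioms) auto
    then show ?thesis by eventually_elim (use u v m0 in simp)
  qed
qed

lemma integrable_mult_iexp:
  fixes h :: "real \<Rightarrow> complex"
  assumes "integrable lborel h"
  shows "integrable lborel (\<lambda>l. h l * exp (\<i> * of_real l * of_real x))"
proof (rule Bochner_Integration.integrable_bound[OF assms])
  show "(\<lambda>l. h l * exp (\<i> * of_real l * of_real x)) \<in> borel_measurable lborel" using assms by measurable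
  have "norm (exp (\<i> * of_real l * of_real x)) = 1" for l
    using norm_exp_i_times[of "l * x"] by (simp add: mult.assoc)
  then show "AE l in lborel. norm (h l * exp (\<i> * of_real l * of_real x)) \<le> norm (h l)" by (simp add: norm_mult)
qed

text \<open>The positive and negative parts have equal transforms, hence agree almost everywhere; as
  they are never both nonzero, both vanish.\<close>

lemma real_fourier_zero:
  fixes u :: "real \<Rightarrow> real"
  assumes u: "integrable lborel u" and z: "\<And>x. (LINT l|lborel. of_real (u l) * exp (\<i> * of_real l * of_real x)) = 0"
  shows "AE x in lborel. u x = 0"
proof -
  have i: "integrable lborel (\<lambda>x. max 0 (u x))" "integrable lborel (\<lambda>x. max 0 (- u x))" using u by auto
  have "AE x in lborel. max 0 (u x) = max 0 (- u x)"
  proof (rule nonneg_fourier_unique[OF i(1) _ i(2)])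
    fix x :: real
    have ii: "integrable lborel (\<lambda>l. complex_of_real (w l) * exp (\<i> * of_real l * of_real x))" if "integrable lborel w" for w
      using that by (intro integrable_mult_iexp integrable_of_real)
    have "(LINT l|lborel. of_real (max 0 (u l)) * exp (\<i> * of_real l * of_real x)) - (LINT l|lborel. of_real (max 0 (- u l)) * exp (\<i> * of_real l * of_real x))
       = (LINT l|lborel. of_real (u l) * exp (\<i> * of_real l * of_real x))"
      unfolding Bochner_Integration.integral_diff[OF ii[OF i(1)] ii[OF i(2)], symmetric]
      by (intro Bochner_Integration.integral_cong refl) (auto simp: max_def simp flip: left_diff_distrib)
    then show "(LINT l|lborel. of_real (max 0 (u l)) * exp (\<i> * of_real l * of_real x)) = (LINT l|lborel. of_real (max 0 (- u l)) * exp (\<i> * of_real l * of_real x))"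
      using z by simp
  qed auto
  then show ?thesis by eventually_elim (auto simp: max_def split: if_splits)
qed

text \<open>Allows the decay known for one transform of \<open>f\<close> to be used for any other.
  The complex case reduces to real and imaginary parts of the difference.\<close>

lemma fourier_transform_unique:
  assumes g: "has_fourier_transform f g" and h: "has_fourier_transform f h"
  shows "AE x in lborel. g x = h x"
proof -
  define d where "d = (\<lambda>x. g x - h x)"
  have ig: "integrable lborel g" "integrable lborel h" using g h by (auto simp: has_fourier_transform_def)
  then have id: "integrable lborel d" unfolding d_def by auto
  have z: "(LINT l|lborel. d l * exp (\<i> * of_real l * of_real x)) = 0" for x
  proof -
    have "(LINT l|lborel. g l * exp (\<i> * of_real l * of_real x)) = (LINT l|lborel. h l * exp (\<i> * of_real l * of_real x))"
      using g h unfolding has_fourier_transform_def by metis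
    then show ?thesis
      unfolding d_def left_diff_distrib
      by (simp add: Bochner_Integration.integral_diff[OF integrable_mult_iexp[OF ig(1)] integrable_mult_iexp[OF ig(2)]])
  qed
  \<comment> \<open>Conjugating the transform at -x gives the transform of \<open>cnj d\<close> at
    x, so real and imaginary part of \<open>d\<close> have zero transform too.\<close>
  have zc: "(LINT l|lborel. cnj (d l) * exp (\<i> * of_real l * of_real x)) = 0" for x
  proof -
    have "(LINT l|lborel. cnj (d l * exp (\<i> * of_real l * of_real (- x)))) = cnj (LINT l|lborel. d l * exp (\<i> * of_real l * of_real (- x)))"
      by (rule Bochner_Integration.integral_cnj)
    also have "\<dots> = 0" using z[of "- x"] by simp
    also have "(\<lambda>l. cnj (d l * exp (\<i> * of_real l * of_real (- x)))) = (\<lambda>l. cnj (d l) * exp (\<i> * of_real l * of_real x))"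
      by (simp add: exp_cnj)
    finally show ?thesis .
  qed
  have i1: "integrable lborel (\<lambda>l. d l * exp (\<i> * of_real l * of_real x))" 
    "integrable lborel (\<lambda>l. cnj (d l) * exp (\<i> * of_real l * of_real x))" for x
    using id by (auto intro!: integrable_mult_iexp)
  have "AE x in lborel. Re (d x) = 0"
  proof (rule real_fourier_zero)
    fix x :: real
    have "(LINT l|lborel. of_real (Re (d l)) * exp (\<i> * of_real l * of_real x))
       = (LINT l|lborel. (d l * exp (\<i> * of_real l * of_real x) + cnj (d l) * exp (\<i> * of_real l * of_real x)) / 2)"
      by (intro Bochner_Integration.integral_cong refl) (simp add: complex_add_cnj flip: distrib_right)
    also have "\<dots> = 0" using i1 z zc by simp
    finally show "(LINT l|lborel. of_real (Re (d l)) * exp (\<i> * of_real l * of_real x)) = 0" .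
  qed (use id in auto)
  moreover have "AE x in lborel. Im (d x) = 0"
  proof (rule real_fourier_zero)
    fix x :: real
    have "(LINT l|lborel. of_real (Im (d l)) * exp (\<i> * of_real l * of_real x))
       = (LINT l|lborel. (d l * exp (\<i> * of_real l * of_real x) - cnj (d l) * exp (\<i> * of_real l * of_real x)) / (2 * \<i>))"
    proof (intro Bochner_Integration.integral_cong refl)
      fix l :: real
      have "d l - cnj (d l) = of_real (Im (d l)) * (2 * \<i>)" by (simp add: complex_eq_iff)
      then show "of_real (Im (d l)) * exp (\<i> * of_real l * of_real x)
          = (d l * exp (\<i> * of_real l * of_real x) - cnj (d l) * exp (\<i> * of_real l * of_real x)) / (2 * \<i>)"
        unfolding left_diff_distrib[symmetric] by (simp only:) (simp add: field_simps)
    qed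
    also have "\<dots> = 0" using i1 z zc by simp
    finally show "(LINT l|lborel. of_real (Im (d l)) * exp (\<i> * of_real l * of_real x)) = 0" .
  qed (use id in auto)
  ultimately show ?thesis by eventually_elim (simp add: d_def complex_eq_iff)
qed

section \<open>Integral representation and tail bounds\<close>

lemma norm_integral_le_AE:
  fixes f :: "'a \<Rightarrow> 'b::{banach,second_countable_topology}"
  assumes "integrable M h" "AE x in M. norm (f x) \<le> h x"
  shows "norm (integral\<^sup>L M f) \<le> integral\<^sup>L M h"
proof -
  have "norm (integral\<^sup>L M f) \<le> (LINT x|M. norm (f x))" by (rule integral_norm_bound)
  also have "\<dots> \<le> integral\<^sup>L M h"
    using assms by (intro integral_mono_AE') (auto elim!: eventually_mono intro: order.trans[OF norm_ge_zero])
  finally show ?thesis .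
qed

section \<open>Integrals of powers over half-lines\<close>

lemma lborel_powr_to_inf:
  fixes a e :: real
  assumes "e < -1" "a > 0"
  shows "integrable lborel (\<lambda>x. indicator {a..} x * x powr e)"
    and "(LINT x|lborel. indicator {a..} x * x powr e) = - (a powr (e + 1)) / (e + 1)"
proof -
  have hi: "((\<lambda>x. x powr e) has_integral -(a powr (e+1)) / (e+1)) {a..}"
    by (rule has_integral_powr_to_inf[OF assms])
  then have "((\<lambda>x. if x \<in> {a..} then x powr e else 0) has_integral -(a powr (e+1)) / (e+1)) UNIV"
    by (simp only: has_integral_restrict_UNIV)
  then have hi': "((\<lambda>x. indicator {a..} x * x powr e) has_integral -(a powr (e+1)) / (e+1)) UNIV"
    by (rule has_integral_eq[rotated]) (auto simp: indicator_def)
  have nn: "(\<integral>\<^sup>+ x. ennreal (indicator {a..} x * x powr e) \<partial>lborel) = ennreal (-(a powr (e+1)) / (e+1))"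
    by (rule nn_integral_has_integral_lborel[OF _ _ hi']) auto
  have pos: "-(a powr (e+1)) / (e+1) \<ge> 0" using assms by (simp add: divide_nonneg_neg)
  show "integrable lborel (\<lambda>x. indicator {a..} x * x powr e)"
    by (rule integrableI_nonneg) (auto simp: nn)
  show "(LINT x|lborel. indicator {a..} x * x powr e) = - (a powr (e + 1)) / (e + 1)"
    by (subst integral_eq_nn_integral) (auto simp only: nn enn2real_ennreal[OF pos], auto)
qed

lemma integrable_one_plus_abs_powr:
  fixes e :: real
  assumes "e < -1"
  shows "integrable lborel (\<lambda>l. (1 + \<bar>l\<bar>) powr e)"
proof -
  define G where "G = (\<lambda>x::real. indicator {1..} x * x powr e)"
  have G: "integrable lborel G" unfolding G_def by (rule lborel_powr_to_inf) (use assms in auto)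
  \<comment> \<open>\<open>G\<close> is supported on [1, \<infinity>), so these substitutions cover
    l >= 0 and l <= 0 respectively.\<close>
  have "integrable lborel (\<lambda>l. G (1 + 1 * l))" "integrable lborel (\<lambda>l. G (1 + (-1) * l))"
    using lborel_integrable_real_affine_iff[of 1 G 1] lborel_integrable_real_affine_iff[of "-1" G 1] G by auto
  then have "integrable lborel (\<lambda>l. G (1 + 1 * l) + G (1 + (-1) * l))" by (rule Bochner_Integration.integrable_add)
  then show ?thesis
    by (rule Bochner_Integration.integrable_bound) (auto simp: G_def indicator_def abs_if)
qed

lemma integral_abs_powr_tail:
  fixes e R :: real
  assumes "e < -1" "R > 0"
  shows "integrable lborel (\<lambda>l. indicator {l. R < \<bar>l\<bar>} l * \<bar>l\<bar> powr e)"
    and "(LINT l|lborel. indicator {l. R < \<bar>l\<bar>} l * \<bar>l\<bar> powr e) \<le> 2 / (- e - 1) * R powr (e + 1)"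
proof -
  define G where "G = (\<lambda>x::real. indicator {R..} x * x powr e)"
  have G: "integrable lborel G" "integral\<^sup>L lborel G = - (R powr (e + 1)) / (e + 1)"
    unfolding G_def using lborel_powr_to_inf[OF assms] by auto
  have i: "integrable lborel (\<lambda>l. G (0 + (-1) * l))" using lborel_integrable_real_affine_iff[of "-1" G 0] G by auto
  have i2: "integral\<^sup>L lborel (\<lambda>l. G (0 + (-1) * l)) = integral\<^sup>L lborel G"
    using lborel_integral_real_affine[of "-1" G 0] by simp
  have i3: "integrable lborel (\<lambda>l. G l + G (0 + (-1) * l))" using G(1) i by (rule Bochner_Integration.integrable_add)
  have le: "indicator {l. R < \<bar>l\<bar>} l * \<bar>l\<bar> powr e \<le> G l + G (0 + (-1) * l)" for l
    using assms by (auto simp: G_def indicator_def abs_if)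
  show i0: "integrable lborel (\<lambda>l. indicator {l. R < \<bar>l\<bar>} l * \<bar>l\<bar> powr e)"
  proof (rule Bochner_Integration.integrable_bound[OF i3])
    show "AE l in lborel. norm (indicator {l. R < \<bar>l\<bar>} l * \<bar>l\<bar> powr e) \<le> norm (G l + G (0 + (-1) * l))"
    proof (intro AE_I2)
      fix l
      show "norm (indicator {l. R < \<bar>l\<bar>} l * \<bar>l\<bar> powr e) \<le> norm (G l + G (0 + (-1) * l))"
        using le[of l] abs_ge_self[of "G l + G (0 + (-1) * l)"] by (simp add: abs_mult)
    qed
  qed measurable
  have "(LINT l|lborel. indicator {l. R < \<bar>l\<bar>} l * \<bar>l\<bar> powr e) \<le> (LINT l|lborel. G l + G (0 + (-1) * l))"
    by (rule integral_mono[OF i0 i3 le])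
  also have "\<dots> = - 2 * (R powr (e + 1)) / (e + 1)"
    using Bochner_Integration.integral_add[OF G(1) i] i2 G(2) by simp
  also have "\<dots> = 2 / (- e - 1) * R powr (e + 1)" using assms by (simp add: field_simps)
  finally show "(LINT l|lborel. indicator {l. R < \<bar>l\<bar>} l * \<bar>l\<bar> powr e) \<le> 2 / (- e - 1) * R powr (e + 1)" .
qed

lemma continuous_on_euler_factors: "continuous_on A (\<lambda>l. euler_factors k \<alpha> n (l / c))"
  unfolding euler_factors_def divide_inverse
  by (intro continuous_intros)

text \<open>Inserting the inversion formula twists the coefficients by n^(it) with t = l / ln N,
  which keeps them completely multiplicative. Sum and integral commute because the sum is
  finite.\<close>

lemma S_Omega_eq_integral:
  assumes k: "k \<ge> 1" and N: "N \<ge> 2" and f: "has_fourier_transform f g"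
  shows "S_Omega f k \<alpha> N = (LINT l|lborel. g l * euler_factors k \<alpha> (nat \<lfloor>N\<rfloor>) (l / ln N))"
proof -
  have ig: "integrable lborel g" using f by (simp add: has_fourier_transform_def)
  define c where "c = (\<lambda>n. \<alpha> ^ bigomega n / complex_of_nat n)"
  define e where "e = (\<lambda>n l. exp (\<i> * of_real l * complex_of_real (ln (real n) / ln N)))"
  have euler: "(\<Sum>n\<in>kfree_smooth k N. c n * e n l) = euler_factors k \<alpha> (nat \<lfloor>N\<rfloor>) (l / ln N)" for l
  proof -
    have "(\<Sum>n\<in>kfree_smooth k N. c n * e n l) = (\<Prod>p\<in>primes_upto (nat \<lfloor>N\<rfloor>). \<Sum>j<k. (c p * e p l) ^ j)"
    proof (rule euler_product_kfree_smooth[OF k])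
      show "c (a * b) * e (a * b) l = c a * e a l * (c b * e b l)" if "a > 0" "b > 0" for a b
      proof -
        have "e (a * b) l = e a l * e b l" 
          using that N by (simp add: e_def ln_mult add_divide_distrib algebra_simps flip: exp_add)
        then show ?thesis using that by (simp add: c_def bigomega_mult power_add)
      qed
    qed (use N in \<open>auto simp: c_def e_def bigomega_def\<close>)
    also have "\<dots> = euler_factors k \<alpha> (nat \<lfloor>N\<rfloor>) (l / ln N)"
      unfolding euler_factors_def
    proof (intro prod.cong refl sum.cong)
      fix p j assume "p \<in> primes_upto (nat \<lfloor>N\<rfloor>)"
      then have "c p = \<alpha> / of_nat p" by (simp add: c_def bigomega_prime)
      moreover have "e p l = exp (\<i> * of_real (l / ln N * ln (real p)))" by (simp add: e_def mult.assoc)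
      ultimately show "(c p * e p l) ^ j = (\<alpha> * exp (\<i> * of_real (l / ln N * ln (real p))) / of_nat p) ^ j"
        by simp
    qed
    finally show ?thesis .
  qed
  have "S_Omega f k \<alpha> N = (\<Sum>n\<in>kfree_smooth k N. (LINT l|lborel. g l * e n l) * c n)"
    using f unfolding S_Omega_def has_fourier_transform_def c_def e_def by (intro sum.cong refl) metis
  also have "\<dots> = (\<Sum>n\<in>kfree_smooth k N. (LINT l|lborel. g l * e n l * c n))" by simp
  also have "\<dots> = (LINT l|lborel. (\<Sum>n\<in>kfree_smooth k N. g l * e n l * c n))"
    by (rule Bochner_Integration.integral_sum[symmetric])
       (use integrable_mult_iexp[OF ig] in \<open>auto simp: e_def simp del: of_real_divide\<close>)
  also have "\<dots> = (LINT l|lborel. g l * (\<Sum>n\<in>kfree_smooth k N. c n * e n l))"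
    by (simp add: sum_distrib_left mult_ac)
  finally show ?thesis by (simp only: euler)
qed

text \<open>Triangle inequality in every factor; at |\<alpha>| and \<open>t = 0\<close> all terms
  are nonnegative reals, so nothing cancels.\<close>

lemma norm_euler_factors_le:
  "norm (euler_factors k \<alpha> n t) \<le> norm (euler_factors k (of_real (norm \<alpha>)) n 0)"
proof -
  have "norm (euler_factors k \<alpha> n t) \<le> (\<Prod>p\<in>primes_upto n. \<Sum>j<k. (norm \<alpha> / p) ^ j)"
    unfolding euler_factors_def prod_norm[symmetric]
  proof (intro prod_mono conjI norm_ge_zero sum_norm_le)
    fix p j
    have "norm (exp (\<i> * of_real (t * ln (real p)))) = 1" by (rule norm_exp_i_times)
    then show "norm ((\<alpha> * exp (\<i> * of_real (t * ln (real p))) / of_nat p) ^ j) \<le> (norm \<alpha> / p) ^ j"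
      unfolding norm_power norm_divide norm_mult by simp
  qed
  also have "\<dots> = norm (complex_of_real (\<Prod>p\<in>primes_upto n. \<Sum>j<k. (norm \<alpha> / p) ^ j))"
    unfolding norm_of_real by (rule abs_of_nonneg[symmetric]) (intro prod_nonneg sum_nonneg ballI zero_le_power; simp)
  also have "complex_of_real (\<Prod>p\<in>primes_upto n. \<Sum>j<k. (norm \<alpha> / p) ^ j) = euler_factors k (of_real (norm \<alpha>)) n 0"
    by (simp add: euler_factors_def)
  finally show ?thesis .
qed

lemma norm_log_power: "N > 1 \<Longrightarrow> norm (log_power N \<alpha>) = ln N powr Re \<alpha>"
  by (simp add: log_power_def powr_def)

text \<open>The asymptotics are applied to |\<alpha>| at \<open>l = 0\<close>, where
  \<open>phi\<close> is 1 and |d| <= K since \<open>ln (ln N) \<le> ln N\<close>. The bound is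
  uniform in \<open>t\<close>.\<close>

lemma euler_factors_bound:
  assumes k: "k \<ge> 2" and \<alpha>: "norm \<alpha> < 2"
  obtains M where "M > 0" "\<And>N t. N \<ge> exp (exp 1) \<Longrightarrow> norm (euler_factors k \<alpha> (nat \<lfloor>N\<rfloor>) t) \<le> M * ln N powr norm \<alpha>"
proof -
  define a where "a = complex_of_real (norm \<alpha>)"
  obtain C K where CK: "C \<noteq> 0" "K > 0"
    "\<And>N l. N \<ge> exp (exp 1) \<Longrightarrow> \<exists>d. euler_factors k a (nat \<lfloor>N\<rfloor>) (l / ln N) = C * log_power N a * phi a l * exp d
        \<and> norm d \<le> K * (1 + \<bar>l\<bar>) * (ln (ln N) / ln N)"
    using euler_factors_asymptotics[OF k, of a] \<alpha> by (auto simp: a_def)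
  show ?thesis
  proof (rule that[of "norm C * exp K"])
    show "norm C * exp K > 0" using CK by simp
    fix N t :: real assume N: "N \<ge> exp (exp 1)"
    have N1: "N > 1" using N by (smt (verit) exp_gt_zero one_less_exp_iff)
    obtain d where d: "euler_factors k a (nat \<lfloor>N\<rfloor>) 0 = C * log_power N a * phi a 0 * exp d" "norm d \<le> K * (ln (ln N) / ln N)"
      using CK(3)[OF N, of 0] by auto
    have "ln (ln N) \<le> ln N - 1" using N1 by (intro ln_le_minus_one) auto
    then have "ln (ln N) / ln N \<le> 1" 
      using divide_le_eq_1_pos[of "ln N" "ln (ln N)"] ln_gt_zero[OF N1] by linarith
    then have "norm d \<le> K" using d(2) CK(2) mult_left_mono[of "ln (ln N) / ln N" 1 K] by simp
    then have "norm (exp d) \<le> exp K" using norm_exp[of d] by (meson exp_le_cancel_iff order.trans)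
    moreover have "norm (log_power N a) = ln N powr norm \<alpha>" using norm_log_power[OF N1, of a] by (simp add: a_def)
    moreover have "phi a 0 = 1" by (simp add: phi_eq expint_ratio_0)
    ultimately have "norm (euler_factors k a (nat \<lfloor>N\<rfloor>) 0) \<le> norm C * ln N powr norm \<alpha> * exp K"
      unfolding d(1) norm_mult by (simp add: mult_left_mono)
    then show "norm (euler_factors k \<alpha> (nat \<lfloor>N\<rfloor>) t) \<le> norm C * exp K * ln N powr norm \<alpha>"
      using norm_euler_factors_le[of k \<alpha> "nat \<lfloor>N\<rfloor>" t] by (simp add: a_def mult_ac)
  qed
qed

text \<open>For D >= 1 the modulus is at most 2 exp(D). For D < 1 it is at most D exp(D), which
  D^\<theta> dominates when \<theta> <= 1; for \<theta> > 1 the linear term 3D takes over.\<close>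

lemma norm_exp_minus_one_le:
  fixes d :: complex
  assumes d: "norm d \<le> D" and \<theta>: "\<theta> > 0"
  shows "norm (exp d - 1) \<le> 2 * D powr \<theta> * exp D + (if \<theta> > 1 then 3 * D else 0)"
proof -
  have D0: "D \<ge> 0" using d norm_ge_zero[of d] by linarith
  have e1: "norm (exp z) \<le> exp D" if "norm z \<le> D" for z :: complex
    using norm_exp[of z] that by (meson exp_le_cancel_iff order.trans)
  show ?thesis
  proof (cases "D \<ge> 1")
    case True
    have "norm (exp d - 1) \<le> exp D + 1" using e1[OF d] norm_triangle_ineq4[of "exp d" 1] unfolding norm_one by linarith
    also have "\<dots> \<le> 2 * 1 * exp D" using D0 by simp
    also have "\<dots> \<le> 2 * D powr \<theta> * exp D" using True \<theta> by (intro mult_mono ge_one_powr_ge_zero) auto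
    finally show ?thesis using D0 by simp
  next
    case False
    have "norm (exp d - exp 0) \<le> exp D * norm (d - 0)"
      by (rule field_differentiable_bound[of "cball 0 D" exp exp]) (use d D0 e1 in \<open>auto intro!: derivative_eq_intros\<close>)
    also have "exp D * norm (d - 0) \<le> exp D * D" using d by (intro mult_left_mono) auto
    finally have b: "norm (exp d - 1) \<le> D * exp D" by (simp add: mult.commute)
    show ?thesis
    proof (cases "\<theta> > 1")
      case True
      have "exp D \<le> exp 1" using False by simp
      also have "\<dots> \<le> (3::real)" by (rule exp_le)
      finally have "D * exp D \<le> D * 3" using D0 by (intro mult_left_mono) auto
      moreover have "0 \<le> 2 * D powr \<theta> * exp D" by simp
      ultimately have "D * exp D \<le> 2 * D powr \<theta> * exp D + 3 * D" by linarith
      then show ?thesis using b True by simp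
    next
      case \<theta>1: False
      have "D \<le> D powr \<theta>"
      proof (cases "D = 0")
        case False
        then have "D powr 1 \<le> D powr \<theta>" using D0 \<open>\<not> D \<ge> 1\<close> \<theta>1 by (intro powr_mono') auto
        then show ?thesis using D0 by simp
      qed simp
      then have "D * exp D \<le> 2 * D powr \<theta> * exp D" using D0 by (intro mult_right_mono) auto
      from order.trans[OF b this] show ?thesis using \<theta>1 by simp
    qed
  qed
qed

text \<open>The decaying transform given by the class agrees with \<open>g\<close> almost everywhere
  by uniqueness. The two shapes of the bound compare because (1 + |l|)/2 is at most max(1,
  |l|).\<close>

lemma S_class_decay:
  assumes "f \<in> S_class \<eta>" "has_fourier_transform f g" "\<eta> > 0"
  obtains A where "A > 0" "AE l in lborel. norm (g l) \<le> A * (1 + \<bar>l\<bar>) powr (- \<eta>)"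
proof -
  obtain h C where h: "has_fourier_transform f h" "C > 0" "\<And>l. norm (h l) \<le> C / (1 + \<bar>l\<bar> powr \<eta>)"
    using assms(1) by (auto simp: S_class_def)
  have ae: "AE l in lborel. g l = h l" by (rule fourier_transform_unique[OF assms(2) h(1)])
  have bd: "norm (h l) \<le> (C * 2 powr \<eta>) * (1 + \<bar>l\<bar>) powr (- \<eta>)" for l
  proof -
    have "((1 + \<bar>l\<bar>) / 2) powr \<eta> \<le> 1 + \<bar>l\<bar> powr \<eta>"
    proof (cases "\<bar>l\<bar> \<le> 1")
      case True
      then have "((1 + \<bar>l\<bar>) / 2) powr \<eta> \<le> 1 powr \<eta>" using assms(3) by (intro powr_mono2) auto
      then show ?thesis using powr_ge_zero[of "\<bar>l\<bar>" \<eta>] unfolding powr_one_eq_one by linarith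
    next
      case False
      then have "((1 + \<bar>l\<bar>) / 2) powr \<eta> \<le> \<bar>l\<bar> powr \<eta>" using assms(3) by (intro powr_mono2) auto
      then show ?thesis by simp
    qed
    then have "C / (1 + \<bar>l\<bar> powr \<eta>) \<le> C / ((1 + \<bar>l\<bar>) / 2) powr \<eta>"
      using h(2) by (intro divide_left_mono mult_pos_pos) (auto simp: add_pos_nonneg)
    also have "\<dots> = (C * 2 powr \<eta>) * (1 + \<bar>l\<bar>) powr (- \<eta>)"
      by (simp add: powr_divide powr_minus divide_simps)
    finally show ?thesis using h(3)[of l] by linarith
  qed
  show ?thesis
  proof (rule that[of "C * 2 powr \<eta>"])
    show "C * 2 powr \<eta> > 0" using h(2) by simp
    show "AE l in lborel. norm (g l) \<le> (C * 2 powr \<eta>) * (1 + \<bar>l\<bar>) powr (- \<eta>)"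
      using ae by eventually_elim (simp add: bd)
  qed
qed

section \<open>Error estimate\<close>

text \<open>The estimate for one fixed \<open>N\<close>, with all parameters free: the integral is
  split at |l| = R into \<open>T1\<close>, compared with the main term, and the tail
  \<open>T2\<close>. \<open>X\<close> bounds exp |d| throughout the inner range.\<close>

lemma S_Omega_error_bound:
  fixes \<alpha> C :: complex and \<theta> :: real
  assumes k: "k \<ge> 1" and f: "has_fourier_transform f g"
    and g: "A \<ge> 0" "AE l in lborel. norm (g l) \<le> A * (1 + \<bar>l\<bar>) powr (- \<eta>)"
    and N: "N \<ge> exp (exp 1)" and R: "R > 0" and \<eta>: "\<eta> > 1" and K: "K > 0"
    and asym: "\<And>l. \<exists>d. euler_factors k \<alpha> (nat \<lfloor>N\<rfloor>) (l / ln N) = C * log_power N \<alpha> * phi \<alpha> l * exp d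
        \<and> norm d \<le> K * (1 + \<bar>l\<bar>) * u"
    and bd: "\<And>t. norm (euler_factors k \<alpha> (nat \<lfloor>N\<rfloor>) t) \<le> M" "M \<ge> 0"
    and u: "u \<ge> 0" and X: "exp (K * (1 + R) * u) \<le> X"
    and \<theta>: "\<theta> > 0" "Re \<alpha> + \<eta> > 1 + \<theta>" 
  shows "norm (S_Omega f k \<alpha> N - C * log_power N \<alpha> * (LINT l:{l. \<bar>l\<bar> \<le> R}|lborel. phi \<alpha> l * g l))
    \<le> norm (C * log_power N \<alpha>) * (A * exp (5 * norm \<alpha>) *
        (2 * (K * u) powr \<theta> * X * (LINT l|lborel. (1 + \<bar>l\<bar>) powr (\<theta> - Re \<alpha> - \<eta>))
         + (if \<theta> > 1 then 3 * (K * u) * (LINT l|lborel. (1 + \<bar>l\<bar>) powr (1 - Re \<alpha> - \<eta>)) else 0)))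
      + M * A * (2 / (\<eta> - 1) * R powr (1 - \<eta>))"
proof -
  define E where "E = (\<lambda>l. euler_factors k \<alpha> (nat \<lfloor>N\<rfloor>) (l / ln N))"
  define Q where "Q = C * log_power N \<alpha>"
  define I :: "real \<Rightarrow> real" where "I = indicator {l. \<bar>l\<bar> \<le> R}"
  define J :: "real \<Rightarrow> real" where "J = indicator {l. R < \<bar>l\<bar>}"
  have IJ: "I l + J l = 1" for l by (auto simp: I_def J_def indicator_def)
  have N2: "N \<ge> 2" using N exp_exp_1_ge_2 by linarith
  have ig: "integrable lborel g" using f by (simp add: has_fourier_transform_def)
  have [measurable]: "g \<in> borel_measurable lborel" using ig by auto
  have [measurable]: "E \<in> borel_measurable lborel" "phi \<alpha> \<in> borel_measurable lborel" "I \<in> borel_measurable lborel" "J \<in> borel_measurable lborel"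
    unfolding E_def I_def J_def
    using borel_measurable_continuous_onI[OF continuous_on_euler_factors] borel_measurable_continuous_onI[OF continuous_on_phi] by auto
  have igE: "integrable lborel (\<lambda>l. g l * E l)"
  proof (rule Bochner_Integration.integrable_bound[of _ "\<lambda>l. M *\<^sub>R g l"])
    have "norm (g l * E l) \<le> norm (M *\<^sub>R g l)" for l
    proof -
      have "norm (g l) * norm (E l) \<le> norm (g l) * M" using bd by (intro mult_left_mono) (auto simp: E_def)
      then show ?thesis using bd(2) by (simp add: norm_mult mult.commute)
    qed
    then show "AE l in lborel. norm (g l * E l) \<le> norm (M *\<^sub>R g l)" by auto
  qed (use ig in auto)
  \<comment> \<open>By continuity \<open>phi\<close> is bounded on the compact range, whatever its
    growth at infinity.\<close>
  have ip: "integrable lborel (\<lambda>l. I l *\<^sub>R (phi \<alpha> l * g l))"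
  proof -
    have "bounded (phi \<alpha> ` {-R..R})" by (intro compact_imp_bounded compact_continuous_image continuous_on_phi) auto
    then obtain B where B: "\<forall>l\<in>{-R..R}. norm (phi \<alpha> l) \<le> B" by (auto simp: bounded_iff)
    have B0: "B \<ge> 0" using order.trans[OF norm_ge_zero bspec[OF B, of 0]] R by simp
    show ?thesis
    proof (rule Bochner_Integration.integrable_bound[of _ "\<lambda>l. B *\<^sub>R g l"])
      have "norm (I l *\<^sub>R (phi \<alpha> l * g l)) \<le> norm (B *\<^sub>R g l)" for l
        using bspec[OF B, of l] B0 by (auto simp: I_def indicator_def norm_mult abs_le_iff intro!: mult_right_mono)
      then show "AE l in lborel. norm (I l *\<^sub>R (phi \<alpha> l * g l)) \<le> norm (B *\<^sub>R g l)" by auto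
    qed (use ig in auto)
  qed
  have i1: "integrable lborel (\<lambda>l. I l *\<^sub>R (g l * E l))" "integrable lborel (\<lambda>l. J l *\<^sub>R (g l * E l))"
    by (rule Bochner_Integration.integrable_bound[OF igE]; auto simp: I_def J_def indicator_def)+
  define T1 where "T1 = (LINT l|lborel. I l *\<^sub>R (g l * E l) - Q * (I l *\<^sub>R (phi \<alpha> l * g l)))"
  define T2 where "T2 = (LINT l|lborel. J l *\<^sub>R (g l * E l))"
  have "S_Omega f k \<alpha> N = (LINT l|lborel. g l * E l)" unfolding E_def by (rule S_Omega_eq_integral[OF k N2 f])
  also have "\<dots> = (LINT l|lborel. I l *\<^sub>R (g l * E l) + J l *\<^sub>R (g l * E l))"
    by (simp flip: scaleR_add_left add: IJ)
  also have "\<dots> = (LINT l|lborel. I l *\<^sub>R (g l * E l)) + T2" unfolding T2_def by (rule Bochner_Integration.integral_add[OF i1])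
  finally have S: "S_Omega f k \<alpha> N = (LINT l|lborel. I l *\<^sub>R (g l * E l)) + T2" .
  have "T1 = (LINT l|lborel. I l *\<^sub>R (g l * E l)) - Q * (LINT l|lborel. I l *\<^sub>R (phi \<alpha> l * g l))"
    unfolding T1_def Bochner_Integration.integral_diff[OF i1(1) integrable_mult_right[OF ip]] integral_mult_right_zero ..
  then have S2: "S_Omega f k \<alpha> N - Q * (LINT l:{l. \<bar>l\<bar> \<le> R}|lborel. phi \<alpha> l * g l) = T1 + T2"
    unfolding S set_lebesgue_integral_def I_def by simp
  have T2b: "norm T2 \<le> M * A * (2 / (\<eta> - 1) * R powr (1 - \<eta>))"
  proof -
    note tl = integral_abs_powr_tail[of "- \<eta>" R, folded J_def]
    have "norm T2 \<le> (LINT l|lborel. M * A * (J l * \<bar>l\<bar> powr (- \<eta>)))"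
      unfolding T2_def
    proof (rule norm_integral_le_AE)
      show "integrable lborel (\<lambda>l. M * A * (J l * \<bar>l\<bar> powr - \<eta>))" using tl \<eta> R by (intro integrable_mult_right) auto
      show "AE l in lborel. norm (J l *\<^sub>R (g l * E l)) \<le> M * A * (J l * \<bar>l\<bar> powr - \<eta>)"
        using g(2)
      proof eventually_elim
        case (elim l)
        show ?case
        proof (cases "R < \<bar>l\<bar>")
          case True
          have "(1 + \<bar>l\<bar>) powr (- \<eta>) \<le> \<bar>l\<bar> powr (- \<eta>)" using True R \<eta> by (intro powr_mono2') auto
          then have "norm (g l) \<le> A * \<bar>l\<bar> powr (- \<eta>)" using elim g(1) mult_left_mono order.trans by blast
          then have "norm (g l) * norm (E l) \<le> (A * \<bar>l\<bar> powr (- \<eta>)) * M"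
            using bd g(1) by (intro mult_mono) (auto simp: E_def)
          then show ?thesis using True by (simp add: J_def norm_mult mult_ac)
        qed (simp add: J_def)
      qed
    qed
    also have "\<dots> = M * A * (LINT l|lborel. J l * \<bar>l\<bar> powr (- \<eta>))" by simp
    also have "\<dots> \<le> M * A * (2 / (\<eta> - 1) * R powr (1 - \<eta>))"
      using tl(2) \<eta> R bd(2) g(1) by (intro mult_left_mono) (auto simp: add.commute)
    finally show ?thesis .
  qed
  define c where "c = exp (5 * norm \<alpha>)"
  \<comment> \<open>Majorant of the integrand of \<open>T1\<close>: \<open>g\<close> contributes the
    power -\<eta> of 1 + |l|, \<open>phi\<close> the power -Re \<alpha>, and exp d - 1 the power
    \<theta>, or 1 in the linear term.\<close>
  define h where "h = (\<lambda>l. norm Q * (A * c * (2 * (K * u) powr \<theta> * X * (1 + \<bar>l\<bar>) powr (\<theta> - Re \<alpha> - \<eta>)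
       + (if \<theta> > 1 then 3 * (K * u) * (1 + \<bar>l\<bar>) powr (1 - Re \<alpha> - \<eta>) else 0))))"
  have j1: "integrable lborel (\<lambda>l. (1 + \<bar>l\<bar>) powr (\<theta> - Re \<alpha> - \<eta>))"
    by (rule integrable_one_plus_abs_powr) (use \<theta> in linarith)
  \<comment> \<open>If \<theta> > 1, the hypothesis gives Re \<alpha> + \<eta> > 2, so this exponent
    lies below -1 as well.\<close>
  have j2: "integrable lborel (\<lambda>l. (if \<theta> > 1 then 3 * (K * u) * (1 + \<bar>l\<bar>) powr (1 - Re \<alpha> - \<eta>) else 0))"
  proof (cases "\<theta> > 1")
    case True
    then have "integrable lborel (\<lambda>l. (1 + \<bar>l\<bar>) powr (1 - Re \<alpha> - \<eta>))"
      by (intro integrable_one_plus_abs_powr) (use \<theta> in linarith)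
    then show ?thesis using True by simp
  qed simp
  have X0: "X \<ge> 0" using X exp_ge_zero order.trans by blast
  have T1b: "norm T1 \<le> (LINT l|lborel. h l)"
    unfolding T1_def
  proof (rule norm_integral_le_AE)
    show "integrable lborel h" unfolding h_def using j1 j2 by (intro integrable_mult_right Bochner_Integration.integrable_add)
    show "AE l in lborel. norm (I l *\<^sub>R (g l * E l) - Q * (I l *\<^sub>R (phi \<alpha> l * g l))) \<le> h l"
      using g(2)
    proof eventually_elim
      case (elim l)
      define y where "y = 1 + \<bar>l\<bar>"
      have y: "y > 0" by (simp add: y_def)
      have h0: "h l \<ge> 0" unfolding h_def c_def using g(1) K u X0 by (intro mult_nonneg_nonneg add_nonneg_nonneg) auto
      show ?case
      proof (cases "\<bar>l\<bar> \<le> R")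
        case True
        obtain d where d: "E l = Q * phi \<alpha> l * exp d" "norm d \<le> K * y * u"
          using asym[of l] by (auto simp: E_def Q_def y_def)
        have "norm (exp d - 1) \<le> 2 * (K * y * u) powr \<theta> * exp (K * y * u) + (if \<theta> > 1 then 3 * (K * y * u) else 0)"
          by (rule norm_exp_minus_one_le[OF d(2) \<theta>(1)])
        also have "\<dots> \<le> 2 * (K * y * u) powr \<theta> * X + (if \<theta> > 1 then 3 * (K * y * u) else 0)"
        proof (intro add_mono mult_left_mono order.refl)
          have "K * y * u \<le> K * (1 + R) * u" using True K u by (intro mult_right_mono mult_left_mono) (auto simp: y_def)
          then show "exp (K * y * u) \<le> X" using X by (meson exp_le_cancel_iff order.trans)
        qed simp
        also have "(K * y * u) powr \<theta> = (K * u) powr \<theta> * y powr \<theta>"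
          using K u y by (simp add: powr_mult[symmetric] mult_ac)
        finally have W: "norm (exp d - 1) \<le> 2 * ((K * u) powr \<theta> * y powr \<theta>) * X + (if \<theta> > 1 then 3 * (K * y * u) else 0)" .
        have "norm (g l) * norm (phi \<alpha> l) \<le> (A * y powr (- \<eta>)) * (c * y powr (- Re \<alpha>))"
          using elim norm_phi_le[of \<alpha> l] g(1) by (intro mult_mono) (auto simp: y_def c_def)
        also have "\<dots> = A * c * y powr (- Re \<alpha> - \<eta>)" using y by (simp add: powr_diff powr_minus divide_simps mult_ac)
        finally have G: "norm (g l) * norm (phi \<alpha> l) \<le> A * c * y powr (- Re \<alpha> - \<eta>)" .
        have "I l *\<^sub>R (g l * E l) - Q * (I l *\<^sub>R (phi \<alpha> l * g l)) = Q * (g l * phi \<alpha> l * (exp d - 1))"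
          using True by (simp add: I_def d(1) algebra_simps)
        then have "norm (I l *\<^sub>R (g l * E l) - Q * (I l *\<^sub>R (phi \<alpha> l * g l))) = norm Q * (norm (g l) * norm (phi \<alpha> l) * norm (exp d - 1))"
          by (simp only: norm_mult)
        also have "\<dots> \<le> norm Q * ((A * c * y powr (- Re \<alpha> - \<eta>)) * (2 * ((K * u) powr \<theta> * y powr \<theta>) * X + (if \<theta> > 1 then 3 * (K * y * u) else 0)))"
          using g(1) by (intro mult_left_mono[OF mult_mono[OF G W]]) (auto simp: c_def)
        also have "\<dots> = norm Q * (A * c * (2 * (K * u) powr \<theta> * X * (y powr \<theta> * y powr (- Re \<alpha> - \<eta>))
             + (if \<theta> > 1 then 3 * (K * u) * (y powr 1 * y powr (- Re \<alpha> - \<eta>)) else 0)))"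
          using y by (simp add: algebra_simps)
        also have "\<dots> = h l"
          unfolding h_def y_def[symmetric] powr_add[symmetric] by (simp add: diff_diff_eq algebra_simps)
        finally show ?thesis .
      next
        case False
        then show ?thesis using h0 by (simp add: I_def)
      qed
    qed
  qed
  also have "(LINT l|lborel. h l) = norm Q * (A * c *
        (2 * (K * u) powr \<theta> * X * (LINT l|lborel. (1 + \<bar>l\<bar>) powr (\<theta> - Re \<alpha> - \<eta>))
         + (if \<theta> > 1 then 3 * (K * u) * (LINT l|lborel. (1 + \<bar>l\<bar>) powr (1 - Re \<alpha> - \<eta>)) else 0)))"
    unfolding h_def using j1 j2
    by (cases "\<theta> > 1") (auto simp: Bochner_Integration.integral_add)
  finally have T1c: "norm T1 \<le> norm Q * (A * c *
        (2 * (K * u) powr \<theta> * X * (LINT l|lborel. (1 + \<bar>l\<bar>) powr (\<theta> - Re \<alpha> - \<eta>))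
         + (if \<theta> > 1 then 3 * (K * u) * (LINT l|lborel. (1 + \<bar>l\<bar>) powr (1 - Re \<alpha> - \<eta>)) else 0)))" .
  show ?thesis unfolding Q_def[symmetric] c_def[symmetric] S2
    using norm_triangle_ineq[of T1 T2] T1c T2b by linarith
qed

text \<open>A fixed power of \<open>ln (ln N)\<close> is eventually below
  \<open>ln N powr (a / 4)\<close>; with the second factor \<open>ln N powr (a / 4)\<close> this
  makes up the exponent \<open>a / 2\<close>.\<close>

lemma log_log_powr_absorb:
  fixes \<theta> a K :: real
  assumes "\<theta> > 0" "a > 0" "K > 0"
  shows "eventually (\<lambda>N. (K * (ln (ln N) / ln N)) powr \<theta> * ln N powr (a / 4) \<le> ln N powr (a / 2 - \<theta>)) at_top"
proof -
  have "eventually (\<lambda>y::real. (K * ln y) powr \<theta> \<le> y powr (a / 4)) at_top"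
    using assms by real_asymp
  then have "eventually (\<lambda>N::real. (K * ln (ln N)) powr \<theta> \<le> ln N powr (a / 4)) at_top"
    using filterlim_iff[THEN iffD1, OF ln_at_top] by (auto simp: eventually_filtermap)
  then show ?thesis using eventually_gt_at_top[of "exp 1"]
  proof eventually_elim
    case (elim N)
    have N: "N > 0" using elim(2) exp_gt_zero[of 1] by linarith
    then have l: "ln N > 1" using elim(2) by (metis exp_less_cancel_iff exp_ln)
    have "(K * (ln (ln N) / ln N)) powr \<theta> = (K * ln (ln N)) powr \<theta> / ln N powr \<theta>"
      using l assms by (simp add: powr_divide[symmetric])
    also have "\<dots> \<le> ln N powr (a / 4) / ln N powr \<theta>" using elim(1) by (intro divide_right_mono) auto
    finally have "(K * (ln (ln N) / ln N)) powr \<theta> * ln N powr (a / 4) \<le> ln N powr (a / 4) / ln N powr \<theta> * ln N powr (a / 4)"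
      by (intro mult_right_mono) auto
    also have "\<dots> = ln N powr (a / 4 + a / 4 - \<theta>)" by (simp only: powr_add powr_diff times_divide_eq_left)
    finally show ?case by simp
  qed
qed

text \<open>The exponent is o(1) times \<open>ln (ln N)\<close>, because both 1 / ln N and R / ln N
  tend to 0.\<close>

lemma exp_log_log_absorb:
  fixes s K :: real
  assumes "s > 0" "K > 0" "((\<lambda>N. R N / ln N) \<longlongrightarrow> 0) at_top"
  shows "eventually (\<lambda>N. exp (K * (1 + R N) * (ln (ln N) / ln N)) \<le> ln N powr s) at_top"
proof -
  have "((\<lambda>N. K * (1 / ln N) + K * (R N / ln N)) \<longlongrightarrow> K * 0 + K * 0) at_top"
    by (intro tendsto_intros assms(3)) real_asymp
  then have "eventually (\<lambda>N. K * (1 / ln N) + K * (R N / ln N) < s) at_top"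
    using assms(1) by (intro order_tendstoD) auto
  then show ?thesis using eventually_gt_at_top[of "exp 1"]
  proof eventually_elim
    case (elim N)
    have N: "N > 0" using elim(2) exp_gt_zero[of 1] by linarith
    then have l: "ln N > 1" using elim(2) by (metis exp_less_cancel_iff exp_ln)
    have "K * (1 + R N) * (ln (ln N) / ln N) = (K * (1 / ln N) + K * (R N / ln N)) * ln (ln N)"
      using l by (simp add: field_simps)
    also have "\<dots> \<le> s * ln (ln N)" using elim(1) l by (intro mult_right_mono) auto
    finally show ?case using l by (simp add: powr_def)
  qed
qed

section \<open>Choice of the exponents and splitting of the error\<close>

theorem theorem1:
  fixes k :: nat and \<alpha> :: complex
  assumes "k \<ge> 2" and "\<alpha> \<noteq> 0" and "norm \<alpha> < 2"
  shows "\<exists>C::complex. C \<noteq> 0 \<and>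
    (\<forall>(\<eta>::real) (f::real \<Rightarrow> complex) (fhat::real \<Rightarrow> complex) (R::real \<Rightarrow> real).
       \<eta> > norm \<alpha> - Re \<alpha> + 1 \<longrightarrow>
       f \<in> S_class \<eta> \<longrightarrow>
       has_fourier_transform f fhat \<longrightarrow>
       (\<forall>N\<ge>2. R N > 0) \<longrightarrow>
       ((\<lambda>N. R N / ln N) \<longlongrightarrow> 0) at_top \<longrightarrow>
       ((\<lambda>N. ln N powr (norm \<alpha> - Re \<alpha>) / R N powr (\<eta> - 1)) \<longlongrightarrow> 0) at_top \<longrightarrow>
       (\<exists>\<epsilon> \<epsilon>1 \<epsilon>2 :: real \<Rightarrow> complex.
          (\<forall>N\<ge>2. S_Omega f k \<alpha> N =
             C * log_power N \<alpha> * ((LINT l:{l. \<bar>l\<bar> \<le> R N}|lborel. phi \<alpha> l * fhat l) + \<epsilon> N)) \<and>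
          (\<epsilon> \<longlongrightarrow> 0) at_top \<and>
          (\<forall>N\<ge>2. \<epsilon> N = \<epsilon>1 N + \<epsilon>2 N) \<and>
          \<epsilon>1 \<in> O[at_top](\<lambda>N. of_real (ln (ln N) / ln N)) \<and>
          \<epsilon>2 \<in> O[at_top](\<lambda>N. of_real (ln N powr (norm \<alpha> - Re \<alpha>) / R N powr (\<eta> - 1)))))"
proof -
  define a where "a = norm \<alpha>"
  have a: "a > 0" "Re \<alpha> \<le> a" using assms complex_Re_le_cmod by (auto simp: a_def)
  obtain C K where CK: "C \<noteq> 0" "K > 0"
    "\<And>N l. N \<ge> exp (exp 1) \<Longrightarrow> \<exists>d. euler_factors k \<alpha> (nat \<lfloor>N\<rfloor>) (l / ln N) = C * log_power N \<alpha> * phi \<alpha> l * exp d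
        \<and> norm d \<le> K * (1 + \<bar>l\<bar>) * (ln (ln N) / ln N)"
    using euler_factors_asymptotics[OF assms(1,3)] by blast
  obtain M where M: "M > 0" "\<And>N t. N \<ge> exp (exp 1) \<Longrightarrow> norm (euler_factors k \<alpha> (nat \<lfloor>N\<rfloor>) t) \<le> M * ln N powr a"
    using euler_factors_bound[OF assms(1,3)] unfolding a_def by blast
  show ?thesis
  \<comment> \<open>\<open>C\<close> is fixed before \<open>\<eta>\<close>, \<open>f\<close> and
    \<open>R\<close>, hence depends on \<open>k\<close> and \<open>\<alpha>\<close> alone.\<close>
  proof (intro exI[of _ C] conjI allI impI)
    show "C \<noteq> 0" by fact
    fix \<eta> :: real and f g :: "real \<Rightarrow> complex" and R :: "real \<Rightarrow> real"
    assume \<eta>: "\<eta> > norm \<alpha> - Re \<alpha> + 1" and f: "f \<in> S_class \<eta>" and fg: "has_fourier_transform f g"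
      and R: "\<forall>N\<ge>2. R N > 0" and R0: "((\<lambda>N. R N / ln N) \<longlongrightarrow> 0) at_top"
      and B0: "((\<lambda>N. ln N powr (norm \<alpha> - Re \<alpha>) / R N powr (\<eta> - 1)) \<longlongrightarrow> 0) at_top"
    \<comment> \<open>As Re \<alpha> + \<eta> - 1 > a, \<theta> exceeds a/2. The a/2 held back makes
      the exponent of the integral \<open>J1\<close> equal to -1 - a/2.\<close>
    define \<theta> where "\<theta> = Re \<alpha> + \<eta> - 1 - a / 2"
    have \<theta>: "\<theta> > 0" "Re \<alpha> + \<eta> > 1 + \<theta>" and \<eta>1: "\<eta> > 1" using \<eta> a unfolding \<theta>_def a_def by linarith+
    obtain A where A: "A > 0" "AE l in lborel. norm (g l) \<le> A * (1 + \<bar>l\<bar>) powr (- \<eta>)"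
      using S_class_decay[OF f fg] \<eta>1 by auto
    define L where "L = (\<lambda>N. LINT l:{l. \<bar>l\<bar> \<le> R N}|lborel. phi \<alpha> l * g l)"
    \<comment> \<open>Taken as the exact remainder, so the required identity is immediate and only
      the size of \<open>\<epsilon>\<close> for large \<open>N\<close> is left to prove.\<close>
    define \<epsilon> where "\<epsilon> = (\<lambda>N. S_Omega f k \<alpha> N / (C * log_power N \<alpha>) - L N)"
    define B where "B = (\<lambda>N. ln N powr (norm \<alpha> - Re \<alpha>) / R N powr (\<eta> - 1))"
    define u where "u = (\<lambda>N::real. ln (ln N) / ln N)"
    have nz: "C * log_power N \<alpha> \<noteq> 0" for N using CK(1) by (simp add: log_power_def)
    define J1 where "J1 = (LINT l|lborel. (1 + \<bar>l\<bar>) powr (\<theta> - Re \<alpha> - \<eta>))"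
    define J2 where "J2 = (LINT l|lborel. (1 + \<bar>l\<bar>) powr (1 - Re \<alpha> - \<eta>))"
    have J: "J1 \<ge> 0" "J2 \<ge> 0" unfolding J1_def J2_def by (auto intro!: Bochner_Integration.integral_nonneg)
    define c where "c = A * exp (5 * norm \<alpha>)"
    have c0: "c > 0" using A by (simp add: c_def)
    \<comment> \<open>The three summands stem from the \<theta>-power term, the linear term and the
      tail.\<close>
    define c1 where "c1 = c * (2 * J1) + c * (3 * K * J2) + M * A * (2 / (\<eta> - 1)) / norm C"
    have c1: "c1 \<ge> 0" unfolding c1_def using c0 CK M A \<eta>1 J by (intro add_nonneg_nonneg) auto
    have ev: "eventually (\<lambda>N. N \<ge> exp (exp 1) \<and> u N \<ge> 0 \<and> B N \<ge> 0) at_top"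
      using eventually_ge_at_top[of "exp (exp 1)"]
    proof eventually_elim
      case (elim N)
      have "ln N \<ge> exp 1" using elim by (smt (verit) exp_gt_zero ln_ge_iff)
      then have "ln N > 0" "ln (ln N) \<ge> 1" using exp_gt_zero[of 1] by (simp_all add: ln_ge_iff del: exp_gt_zero)
      then have "u N \<ge> 0" unfolding u_def by (intro divide_nonneg_nonneg) linarith+
      then show ?case using elim by (simp add: B_def)
    qed
    have "eventually (\<lambda>N. R N / ln N < 1) at_top" using R0 by (intro order_tendstoD) auto
    \<comment> \<open>The reserve a/2 is shared equally: one a/4 bounds exp |d|, the other the power
      of \<open>ln (ln N)\<close>.\<close>
    moreover have "a / 4 > 0" using a(1) by simp
    note exp_log_log_absorb[OF this CK(2) R0]
    moreover note ev log_log_powr_absorb[OF \<theta>(1) a(1) CK(2)]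
    ultimately have main: "eventually (\<lambda>N. norm (\<epsilon> N) \<le> c1 * (u N + B N)) at_top"
    proof eventually_elim
      case (elim N)
      have N: "N \<ge> exp (exp 1)" and u0: "u N \<ge> 0" and Bp: "B N \<ge> 0" using elim by auto
      have N2: "N \<ge> 2" using N exp_exp_1_ge_2 by linarith
      then have lN: "ln N > 0" by simp
      have Rp: "R N > 0" using R N2 by simp
      have RN: "R N \<le> ln N" using elim lN by simp
      define X where "X = ln N powr (a / 4)"
      have Xb: "(K * u N) powr \<theta> * X \<le> B N"
      proof -
        have "(K * u N) powr \<theta> * X \<le> ln N powr (a / 2 - \<theta>)" using elim by (simp add: X_def u_def)
        also have "a / 2 - \<theta> = (a - Re \<alpha>) + (1 - \<eta>)" by (simp add: \<theta>_def)
        also have "ln N powr \<dots> = ln N powr (a - Re \<alpha>) * ln N powr (1 - \<eta>)" by (rule powr_add)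
        \<comment> \<open>The exponent 1 - \<eta> is negative, so replacing \<open>ln N\<close> by
          the smaller \<open>R N\<close> increases the value.\<close>
        also have "\<dots> \<le> ln N powr (a - Re \<alpha>) * R N powr (1 - \<eta>)"
          using RN Rp \<eta>1 by (intro mult_left_mono powr_mono2') auto
        also have "\<dots> = B N" using powr_minus_divide[of "R N" "\<eta> - 1"] by (simp add: B_def a_def)
        finally show ?thesis .
      qed
      have asymN: "\<exists>d. euler_factors k \<alpha> (nat \<lfloor>N\<rfloor>) (l / ln N) = C * log_power N \<alpha> * phi \<alpha> l * exp d
        \<and> norm d \<le> K * (1 + \<bar>l\<bar>) * u N" for l
        unfolding u_def by (rule CK(3)[OF N])
      have MN: "M * ln N powr a \<ge> 0" using M by simp
      have "norm (S_Omega f k \<alpha> N - C * log_power N \<alpha> * L N)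
        \<le> norm (C * log_power N \<alpha>) * (A * exp (5 * norm \<alpha>) *
            (2 * (K * u N) powr \<theta> * X * J1 + (if \<theta> > 1 then 3 * (K * u N) * J2 else 0)))
          + (M * ln N powr a) * A * (2 / (\<eta> - 1) * R N powr (1 - \<eta>))"
        unfolding L_def J1_def J2_def
        by (rule S_Omega_error_bound[OF _ fg _ A(2) N Rp \<eta>1 CK(2) asymN M(2)[OF N] MN u0 _ \<theta>])
           (use assms A elim in \<open>auto simp: X_def u_def\<close>)
      also have "\<dots> \<le> norm (C * log_power N \<alpha>) * (c * (2 * J1 * B N + 3 * K * J2 * u N))
          + norm (C * log_power N \<alpha>) * (M * A * (2 / (\<eta> - 1)) / norm C * B N)"
      proof (intro add_mono)
        have "2 * (K * u N) powr \<theta> * X * J1 \<le> 2 * J1 * B N"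
          using mult_left_mono[OF Xb, of "2 * J1"] J by (simp add: mult_ac)
        moreover have "(if \<theta> > 1 then 3 * (K * u N) * J2 else 0) \<le> 3 * K * J2 * u N"
          using CK(2) u0 J by (simp add: mult_ac)
        ultimately show "norm (C * log_power N \<alpha>) * (A * exp (5 * norm \<alpha>) *
            (2 * (K * u N) powr \<theta> * X * J1 + (if \<theta> > 1 then 3 * (K * u N) * J2 else 0)))
          \<le> norm (C * log_power N \<alpha>) * (c * (2 * J1 * B N + 3 * K * J2 * u N))"
          unfolding c_def[symmetric] using c0 by (intro mult_left_mono add_mono) auto
        \<comment> \<open>Dividing the trivial bound for the tail by the size of
          \<open>log_power\<close> leaves exactly the numerator of \<open>B\<close>.\<close>
        have "ln N powr a = ln N powr Re \<alpha> * ln N powr (a - Re \<alpha>)" by (simp flip: powr_add)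
        moreover have "R N powr (1 - \<eta>) = 1 / R N powr (\<eta> - 1)" using powr_minus_divide[of "R N" "\<eta> - 1"] by simp
        moreover have "norm (C * log_power N \<alpha>) = norm C * ln N powr Re \<alpha>"
          using norm_log_power[of N \<alpha>] N2 by (simp add: norm_mult)
        ultimately have "(M * ln N powr a) * A * (2 / (\<eta> - 1) * R N powr (1 - \<eta>)) = norm (C * log_power N \<alpha>) * (M * A * (2 / (\<eta> - 1)) / norm C * B N)"
          using CK(1) by (simp add: B_def a_def)
        then show "(M * ln N powr a) * A * (2 / (\<eta> - 1) * R N powr (1 - \<eta>)) \<le> norm (C * log_power N \<alpha>) * (M * A * (2 / (\<eta> - 1)) / norm C * B N)" by simp
      qed
      also have "\<dots> \<le> norm (C * log_power N \<alpha>) * (c1 * (u N + B N))"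
        unfolding distrib_left[symmetric]
      proof (intro mult_left_mono norm_ge_zero)
        have "0 \<le> c * (2 * J1) * u N" "0 \<le> c * (3 * K * J2) * B N" "0 \<le> M * A * (2 / (\<eta> - 1)) / norm C * u N"
          using c0 CK M A \<eta>1 J u0 Bp by (auto intro!: mult_nonneg_nonneg divide_nonneg_nonneg)
        then show "c * (2 * J1 * B N + 3 * K * J2 * u N) + M * A * (2 / (\<eta> - 1)) / norm C * B N \<le> c1 * (u N + B N)"
          unfolding c1_def by (simp only: distrib_left distrib_right mult.assoc)
      qed
      finally have "norm (S_Omega f k \<alpha> N - C * log_power N \<alpha> * L N) \<le> norm (C * log_power N \<alpha>) * (c1 * (u N + B N))" .
      moreover have "S_Omega f k \<alpha> N - C * log_power N \<alpha> * L N = C * log_power N \<alpha> * \<epsilon> N"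
        using nz[of N] by (simp add: \<epsilon>_def right_diff_distrib)
      ultimately have "norm (C * log_power N \<alpha>) * norm (\<epsilon> N) \<le> norm (C * log_power N \<alpha>) * (c1 * (u N + B N))"
        by (simp only: norm_mult)
      moreover have "norm (C * log_power N \<alpha>) > 0" using nz[of N] unfolding zero_less_norm_iff .
      ultimately show ?case by (rule mult_left_le_imp_le)
    qed
    \<comment> \<open>For each \<open>N\<close> the whole error goes to the larger of
      \<open>u\<close> and \<open>B\<close>, since c1 (u + B) is at most 2 c1 times that
      one.\<close>
    define \<epsilon>1 where "\<epsilon>1 = (\<lambda>N. if B N \<le> u N then \<epsilon> N else 0)"
    define \<epsilon>2 where "\<epsilon>2 = (\<lambda>N. if B N \<le> u N then 0 else \<epsilon> N)"
    have "\<epsilon>1 \<in> O[at_top](\<lambda>N. of_real (u N))"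
    proof (rule bigoI)
      show "eventually (\<lambda>N. norm (\<epsilon>1 N) \<le> (2 * c1) * norm (complex_of_real (u N))) at_top"
        using main ev
      proof eventually_elim
        case (elim N)
        have "c1 * (u N + B N) \<le> c1 * (2 * u N)" if "B N \<le> u N" using that c1 by (intro mult_left_mono) auto
        then show ?case using elim c1 by (auto simp: \<epsilon>1_def)
      qed
    qed
    moreover have "\<epsilon>2 \<in> O[at_top](\<lambda>N. of_real (B N))"
    proof (rule bigoI)
      show "eventually (\<lambda>N. norm (\<epsilon>2 N) \<le> (2 * c1) * norm (complex_of_real (B N))) at_top"
        using main ev
      proof eventually_elim
        case (elim N)
        have "c1 * (u N + B N) \<le> c1 * (2 * B N)" if "\<not> B N \<le> u N" using that c1 by (intro mult_left_mono) auto
        then show ?case using elim c1 by (auto simp: \<epsilon>2_def)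
      qed
    qed
    moreover have "(\<epsilon> \<longlongrightarrow> 0) at_top"
    proof (rule Lim_null_comparison[OF main])
      have "(u \<longlongrightarrow> 0) at_top" unfolding u_def by real_asymp
      then have "((\<lambda>N. c1 * (u N + B N)) \<longlongrightarrow> c1 * (0 + 0)) at_top"
        using B0 unfolding B_def[symmetric] by (intro tendsto_intros)
      then show "((\<lambda>N. c1 * (u N + B N)) \<longlongrightarrow> 0) at_top" by simp
    qed
    moreover have "\<forall>N\<ge>2. S_Omega f k \<alpha> N = C * log_power N \<alpha> * (L N + \<epsilon> N)"
      using nz by (simp add: \<epsilon>_def)
    moreover have "\<forall>N\<ge>2. \<epsilon> N = \<epsilon>1 N + \<epsilon>2 N" by (simp add: \<epsilon>1_def \<epsilon>2_def)
    ultimately show "\<exists>\<epsilon> \<epsilon>1 \<epsilon>2 :: real \<Rightarrow> complex.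
          (\<forall>N\<ge>2. S_Omega f k \<alpha> N =
             C * log_power N \<alpha> * ((LINT l:{l. \<bar>l\<bar> \<le> R N}|lborel. phi \<alpha> l * g l) + \<epsilon> N)) \<and>
          (\<epsilon> \<longlongrightarrow> 0) at_top \<and>
          (\<forall>N\<ge>2. \<epsilon> N = \<epsilon>1 N + \<epsilon>2 N) \<and>
          \<epsilon>1 \<in> O[at_top](\<lambda>N. of_real (ln (ln N) / ln N)) \<and>
          \<epsilon>2 \<in> O[at_top](\<lambda>N. of_real (ln N powr (norm \<alpha> - Re \<alpha>) / R N powr (\<eta> - 1)))"
      unfolding L_def B_def u_def by blast
  qed
qed

end
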